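(* Let $P$ be a combinatorial $(n,k)$-hypersimplex with $n\ge 6$. Then $$\mathrm{rk}_+(P)\ \ge\ \begin{cases} n+2k+1, & \text{if } 2\le k<\lfloor \tfrac n2\rfloor,\\ 2n, & \text{if } \lfloor\tfrac n2\rfloor\le k\le\lceil\tfrac n2\rceil,\\ n+2(n-k)+1, & \text{if } \lceil\tfrac n2\rceil<k\le n-2.\end{cases}$$
   Context: For integers $0<k<n$, $\Delta_{n,k}=\mathrm{conv}\{x\in\{0,1\}^n : x_1+\cdots+x_n=k\}\subset\mathbb{R}^n$, a polytope of dimension $n-1$. A combinatorial $(n,k)$-hypersimplex is any polytope whose face lattice is isomorphic to the face lattice of $\Delta_{n,k}$. The extension complexity (nonnegative rank) $\mathrm{rk}_+(P)$ of a convex polytope $P$ is the minimal number of facets of a polytope $\widehat{P}$ (of any dimension) such that $P$ is the image of $\widehat{P}$ under a linear projection (affine map). *)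

theory Defs
  imports "HOL-Analysis.Analysis" "HOL-Analysis.Finite_Function_Topology"
begin

definition hypersimplex :: "nat \<Rightarrow> (real ^ 'n::finite) set" where
  "hypersimplex k =
     convex hull {x. (\<forall>i. x $ i \<in> {0, 1}) \<and> (\<Sum>i\<in>UNIV. x $ i) = real k}"

definition face_lattices_isomorphic :: "'a::real_vector set \<Rightarrow> 'b::real_vector set \<Rightarrow> bool" where
  "face_lattices_isomorphic P Q \<longleftrightarrow>
     (\<exists>\<phi>. bij_betw \<phi> {F. F face_of P} {G. G face_of Q} \<and>
          (\<forall>F F'. F face_of P \<and> F' face_of P \<longrightarrow> (F \<subseteq> F' \<longleftrightarrow> \<phi> F \<subseteq> \<phi> F')))"

text \<open>The ambient dimension \<open>n\<close> of the model hypersimplex is \<open>CARD('n)\<close>; the polytope \<open>P\<close>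
  may live in a Euclidean space of any other dimension.\<close>

definition combinatorial_hypersimplex ::
    "'n::finite itself \<Rightarrow> nat \<Rightarrow> 'a::euclidean_space set \<Rightarrow> bool" where
  "combinatorial_hypersimplex _ k P \<longleftrightarrow>
     polytope P \<and> face_lattices_isomorphic P (hypersimplex k :: (real ^ 'n) set)"

text \<open>The library's \<open>facet_of\<close> requires the type of the ambient space to be Euclidean. The notions
  below make sense in every real vector space (for sets of finite affine dimension), and
  agree with the library's in the Euclidean case: see \<open>facets_euclidean\<close>.
  For the empty set \<open>affdim\<close> is 0 and not -1; this never matters for facets,
  which are nonempty.\<close>

definition affdim :: "'a::real_vector set \<Rightarrow> nat" where
  "affdim S = dim {x - y | x y. x \<in> S \<and> y \<in> S}"

definition facets :: "'a::real_vector set \<Rightarrow> 'a set set" where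
  "facets S = {F. F face_of S \<and> F \<noteq> {} \<and> affdim S = affdim F + 1}"

text \<open>The minimum ranges over polytopes of all dimensions. As one cannot quantify over types,
  they are all taken inside the space of finitely supported sequences
  \<open>nat \<Rightarrow>\<^sub>0 real\<close>, the union of the coordinate spaces of all finite dimensions: a polytope
  in it has finitely many vertices and so lies in one of these coordinate spaces, and
  every polytope in a Euclidean space has a copy there (see \<open>extension_complexity_le\<close>).\<close>

definition extension_complexity :: "'a::euclidean_space set \<Rightarrow> nat" where
  "extension_complexity P =
     (LEAST N. \<exists>(Q :: (nat \<Rightarrow>\<^sub>0 real) set) L c.
        polytope Q \<and> linear L \<and> P = (\<lambda>x. L x + c) ` Q \<and> card (facets Q) = N)"

lemma affdim_translation:
  assumes "a \<in> S"
  shows "affdim S = dim ((\<lambda>x. x - a) ` S)"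
proof -
  have "span {x - y | x y. x \<in> S \<and> y \<in> S} = span ((\<lambda>x. x - a) ` S)"
  proof (rule span_eq[THEN iffD2], rule conjI)
    have "x - y \<in> span ((\<lambda>x. x - a) ` S)" if "x \<in> S" "y \<in> S" for x y
    proof -
      have "(x - a) - (y - a) \<in> span ((\<lambda>x. x - a) ` S)"
        using that by (intro span_diff span_base) auto
      then show ?thesis by simp
    qed
    then show "{x - y | x y. x \<in> S \<and> y \<in> S} \<subseteq> span ((\<lambda>x. x - a) ` S)" by blast
    show "(\<lambda>x. x - a) ` S \<subseteq> span {x - y | x y. x \<in> S \<and> y \<in> S}"
      using assms by (blast intro: span_base)
  qed
  then have "dim (span {x - y | x y. x \<in> S \<and> y \<in> S}) = dim (span ((\<lambda>x. x - a) ` S))"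
    by (rule arg_cong)
  then show ?thesis
    unfolding affdim_def dim_span .
qed

lemma affdim_euclidean:
  fixes S :: "'a::euclidean_space set"
  assumes "S \<noteq> {}"
  shows "int (affdim S) = aff_dim S"
proof -
  obtain a where a: "a \<in> S" using assms by blast
  have "(+) (- a) ` S = (\<lambda>x. x - a) ` S" by auto
  then show ?thesis
    using aff_dim_eq_dim[OF hull_inc[OF a]] affdim_translation[OF a] by simp
qed

lemma facets_euclidean:
  fixes S :: "'a::euclidean_space set"
  shows "facets S = {F. F facet_of S}"
proof -
  have "affdim S = affdim F + 1 \<longleftrightarrow> aff_dim F = aff_dim S - 1"
    if "F face_of S" "F \<noteq> {}" for F
  proof -
    have "S \<noteq> {}" using face_of_imp_subset[OF that(1)] that(2) by auto
    then show ?thesis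
      using affdim_euclidean[of F] affdim_euclidean[of S] that by linarith
  qed
  then show ?thesis
    unfolding facets_def facet_of_def by blast
qed

lemma affdim_injective_linear_image:
  fixes f :: "'a::euclidean_space \<Rightarrow> 'b::real_vector"
  assumes "linear f" "inj f"
  shows "affdim (f ` S) = affdim S"
proof -
  let ?D = "{x - y | x y. x \<in> S \<and> y \<in> S}"
  have "{x - y | x y. x \<in> f ` S \<and> y \<in> f ` S} = f ` ?D"
    using linear_diff[OF assms(1)] by (fastforce simp: image_iff)
  moreover have "dim (f ` ?D) = dim ?D"
  proof -
    obtain B where B: "B \<subseteq> ?D" "independent B" "?D \<subseteq> span B" "card B = dim ?D"
      using basis_exists by blast
    have "independent (f ` B)"
      by (rule linear_independent_injective_image[OF assms(1) B(2)])
         (use assms(2) inj_on_subset in blast)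
    moreover have "f ` ?D \<subseteq> span (f ` B)"
      using linear_span_image[OF assms(1), of B] B(3) by blast
    moreover have "card (f ` B) = card B"
      using assms(2) by (meson card_image inj_on_subset subset_UNIV)
    ultimately show ?thesis
      using dim_unique[OF image_mono[OF B(1)]] B(4) by simp
  qed
  ultimately show ?thesis
    unfolding affdim_def by simp
qed

lemma linear_embedding_poly_mapping:
  "\<exists>e :: 'a::euclidean_space \<Rightarrow> nat \<Rightarrow>\<^sub>0 real. linear e \<and> inj e"
proof -
  obtain h :: "'a \<Rightarrow> nat" where h: "inj_on h Basis"
    using finite_imp_inj_to_nat_seg[OF finite_Basis] by blast
  define e :: "'a \<Rightarrow> nat \<Rightarrow>\<^sub>0 real"
    where "e x = (\<Sum>b\<in>Basis. Poly_Mapping.single (h b) (x \<bullet> b))" for x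
  have scale: "r *\<^sub>R Poly_Mapping.single i a = Poly_Mapping.single i (r * a)"
    for r a :: real and i :: nat
    by (rule poly_mapping_eqI) (simp add: scaleR_poly_mapping_def lookup_single when_def)
  have "linear e"
    by (rule linearI)
       (simp_all add: e_def inner_add_left single_add sum.distrib scale scaleR_sum_right)
  moreover have coord: "Poly_Mapping.lookup (e x) (h b) = x \<bullet> b" if "b \<in> Basis" for x b
  proof -
    have "Poly_Mapping.lookup (e x) (h b) = (\<Sum>c\<in>Basis. if c = b then x \<bullet> c else 0)"
      unfolding e_def lookup_sum
      by (rule sum.cong) (use that h in \<open>auto simp: lookup_single when_def dest: inj_onD\<close>)
    then show ?thesis using that by simp
  qed
  have "inj e"
    by (rule injI, rule euclidean_eqI) (simp flip: coord)
  ultimately show ?thesis by blast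
qed

lemma extension_complexity_le:
  fixes P :: "'a::euclidean_space set" and Q :: "'b::euclidean_space set"
  assumes "polytope Q" "linear L" "P = (\<lambda>x. L x + c) ` Q"
  shows "extension_complexity P \<le> card {F. F facet_of Q}"
proof -
  obtain e :: "'b \<Rightarrow> nat \<Rightarrow>\<^sub>0 real" where e: "linear e" "inj e"
    using linear_embedding_poly_mapping by blast
  obtain g where g: "linear g" "g \<circ> e = id"
    using linear_injective_left_inverse[OF e] by blast
  have ge: "g (e x) = x" for x
    using g(2) by (metis comp_apply id_apply)
  have "facets (e ` Q) = (image e) ` facets Q"
  proof -
    have "facets (e ` Q) = {F \<in> {F. F face_of e ` Q}. F \<noteq> {} \<and> affdim (e ` Q) = affdim F + 1}"
      unfolding facets_def by blast
    also have "\<dots> = (image e) ` facets Q"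
      unfolding faces_of_linear_image[OF e] affdim_injective_linear_image[OF e] facets_def
      by (auto simp: affdim_injective_linear_image[OF e])
    finally show ?thesis .
  qed
  moreover have "inj_on (image e) (facets Q)"
    using e(2) by (simp add: inj_on_def inj_image_eq_iff)
  ultimately have "card (facets (e ` Q)) = card {F. F facet_of Q}"
    by (simp add: card_image facets_euclidean)
  moreover have "polytope (e ` Q)"
    by (rule polytope_linear_image[OF e(1) assms(1)])
  moreover have "linear (L \<circ> g)"
    by (rule linear_compose[OF g(1) assms(2)])
  moreover have "P = (\<lambda>x. (L \<circ> g) x + c) ` (e ` Q)"
    unfolding assms(3) image_image o_def ge ..
  ultimately show ?thesis
    unfolding extension_complexity_def by (intro Least_le) blast
qed

end

theory Submission
  imports Defs
begin

text \<open>Let \<open>Q\<close> be a polytope that projects onto \<open>P\<close>. The preimages in \<open>Q\<close> of the faces of \<open>P\<close>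
  corresponding to \<open>x\<^sub>i = 0\<close> and to \<open>x\<^sub>i = 1\<close> are faces of \<open>Q\<close>, hence intersections of facets.
  Assigning to each facet the indices \<open>i\<close> for which it contains these preimages gives a covering
  of the slack pattern of the hypersimplex by rectangles, one for each facet. Such coverings
  restrict to the facets of the hypersimplex. If \<open>i\<close> occurs in the first component of a single
  rectangle, that rectangle covers exactly the row \<open>x\<^sub>i = 0\<close> and becomes empty on
  \<open>x\<^sub>i = 1\<close>; this yields
  \<open>f n k \<ge> min (f (n - 1) k + 2) (f (n - 1) (k - 1) + 3)\<close> for the least number \<open>f n k\<close> of
  rectangles, and \<open>f n k \<ge> f (n - 1) k + 1\<close> always holds. The theorem follows by induction from
  \<open>f 6 2 \<ge> 11\<close> and \<open>f 6 3 \<ge> 12\<close>, which rest on \<open>f 5 2 \<ge> 9\<close> and \<open>f 4 2 \<ge> 6\<close> through weighted counting.\<close>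

section \<open>Rectangle coverings of hypersimplices\<close>

text \<open>The rectangle with index \<open>j\<close> has the rows \<open>x\<^sub>i = 0\<close> for \<open>i \<in> A j\<close> and \<open>x\<^sub>i = 1\<close> for
  \<open>i \<in> B j\<close>; its columns are the \<open>k\<close>-subsets on which all these slacks are nonzero.\<close>

definition rect_cover :: "'a set \<Rightarrow> nat \<Rightarrow> 'j set \<Rightarrow> ('j \<Rightarrow> 'a set) \<Rightarrow> ('j \<Rightarrow> 'a set) \<Rightarrow> bool" where
  "rect_cover X k J A B \<longleftrightarrow> finite X \<and> finite J \<and> (\<forall>j\<in>J. A j \<subseteq> X \<and> B j \<subseteq> X) \<and>
     (\<forall>S. S \<subseteq> X \<and> card S = k \<longrightarrow>
        (\<forall>i\<in>S. \<exists>j\<in>J. i \<in> A j \<and> A j \<subseteq> S \<and> B j \<inter> S = {}) \<and>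
        (\<forall>i\<in>X - S. \<exists>j\<in>J. i \<in> B j \<and> A j \<subseteq> S \<and> B j \<inter> S = {}))"

lemma rect_coverI:
  assumes "finite X" "finite J" "\<And>j. j \<in> J \<Longrightarrow> A j \<subseteq> X" "\<And>j. j \<in> J \<Longrightarrow> B j \<subseteq> X"
    and "\<And>S i. S \<subseteq> X \<Longrightarrow> card S = k \<Longrightarrow> i \<in> S \<Longrightarrow> \<exists>j\<in>J. i \<in> A j \<and> A j \<subseteq> S \<and> B j \<inter> S = {}"
    and "\<And>S i. S \<subseteq> X \<Longrightarrow> card S = k \<Longrightarrow> i \<in> X - S \<Longrightarrow> \<exists>j\<in>J. i \<in> B j \<and> A j \<subseteq> S \<and> B j \<inter> S = {}"
  shows "rect_cover X k J A B"
  using assms unfolding rect_cover_def by blast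

lemma
  assumes "rect_cover X k J A B"
  shows rect_cover_finite: "finite X" "finite J"
    and rect_cover_subset: "j \<in> J \<Longrightarrow> A j \<subseteq> X" "j \<in> J \<Longrightarrow> B j \<subseteq> X"
    and rect_cover_in: "S \<subseteq> X \<Longrightarrow> card S = k \<Longrightarrow> i \<in> S \<Longrightarrow> \<exists>j\<in>J. i \<in> A j \<and> A j \<subseteq> S \<and> B j \<inter> S = {}"
    and rect_cover_out: "S \<subseteq> X \<Longrightarrow> card S = k \<Longrightarrow> i \<in> X - S \<Longrightarrow> \<exists>j\<in>J. i \<in> B j \<and> A j \<subseteq> S \<and> B j \<inter> S = {}"
  using assms unfolding rect_cover_def by blast+

text \<open>The reflection \<open>x -> 1 - x\<close>, on columns \<open>S -> X - S\<close>,
  exchanges the rows \<open>x_i = 0\<close> and \<open>x_i = 1\<close>, so the same rectangles serve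
  with \<open>A\<close> and \<open>B\<close> swapped.\<close>

lemma rect_cover_dual:
  assumes cov: "rect_cover X k J A B" and "k \<le> card X"
  shows "rect_cover X (card X - k) J B A"
proof (rule rect_coverI)
  show "finite X" "finite J" "\<And>j. j \<in> J \<Longrightarrow> B j \<subseteq> X" "\<And>j. j \<in> J \<Longrightarrow> A j \<subseteq> X"
    using rect_cover_finite[OF cov] rect_cover_subset[OF cov] by auto
  fix S i assume S: "S \<subseteq> X" "card S = card X - k"
  have T: "X - S \<subseteq> X" "card (X - S) = k"
    using S assms(2) \<open>finite X\<close> by (auto simp: card_Diff_subset finite_subset)
  have *: "B j \<subseteq> S \<and> A j \<inter> S = {}" if "j \<in> J" "A j \<subseteq> X - S" "B j \<inter> (X - S) = {}" for j
    using that rect_cover_subset[OF cov] by blast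
  show "\<exists>j\<in>J. i \<in> B j \<and> B j \<subseteq> S \<and> A j \<inter> S = {}" if "i \<in> S"
    using rect_cover_out[OF cov T, of i] * that S(1) by blast
  show "\<exists>j\<in>J. i \<in> A j \<and> B j \<subseteq> S \<and> A j \<inter> S = {}" if "i \<in> X - S"
    using rect_cover_in[OF cov T that] * by blast
qed

section \<open>Restriction of coverings to the facets \<open>x_i = 0\<close> and
  \<open>x_i = 1\<close>\<close>

lemma rect_cover_delete:
  assumes cov: "rect_cover X k J A B"
  shows "rect_cover (X - {i}) k {j \<in> J. i \<notin> A j \<and> \<not> (A j = {} \<and> B j = {i})} A (\<lambda>j. B j - {i})"
proof (rule rect_coverI)
  \<comment> \<open>A column avoiding \<open>i\<close> lies in no rectangle with \<open>i\<close> in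
    \<open>A j\<close>, and a rectangle whose only row is \<open>x_i = 1\<close> has no row left;
    both kinds can go. For the others, \<open>i\<close> in \<open>B j\<close> is no constraint on
    such columns.\<close>
  fix S l assume S: "S \<subseteq> X - {i}" "card S = k"
  then have SX: "S \<subseteq> X" by blast
  show "\<exists>j\<in>{j \<in> J. i \<notin> A j \<and> \<not> (A j = {} \<and> B j = {i})}. l \<in> A j \<and> A j \<subseteq> S \<and> (B j - {i}) \<inter> S = {}"
    if "l \<in> S"
    using rect_cover_in[OF cov SX S(2) that] S(1) by blast
  show "\<exists>j\<in>{j \<in> J. i \<notin> A j \<and> \<not> (A j = {} \<and> B j = {i})}. l \<in> B j - {i} \<and> A j \<subseteq> S \<and> (B j - {i}) \<inter> S = {}"
    if "l \<in> X - {i} - S"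
    using rect_cover_out[OF cov SX S(2), of l] S(1) that by blast
qed (use rect_cover_finite[OF cov] rect_cover_subset[OF cov] in auto)

text \<open>Counts what deletion discards. \<open>M\<close> is any bound valid on the facet, so that
  small cases and induction hypotheses can be plugged in. A rectangle \<open>({}, {i})\<close> is
  discarded without having \<open>i\<close> in its first component, hence the extra 1.\<close>

lemma rect_cover_delete_bound:
  fixes J :: "'j set"
  assumes cov: "rect_cover X k J A B"
    and M: "\<And>(J' :: 'j set) A' B'. rect_cover (X - {i}) k J' A' B' \<Longrightarrow> M \<le> card J'"
  shows "card {j \<in> J. i \<in> A j} + M \<le> card J"
    and "s \<in> J \<Longrightarrow> A s = {} \<Longrightarrow> B s = {i} \<Longrightarrow> card {j \<in> J. i \<in> A j} + M + 1 \<le> card J"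
proof -
  let ?J' = "{j \<in> J. i \<notin> A j \<and> \<not> (A j = {} \<and> B j = {i})}"
  note fin = rect_cover_finite(2)[OF cov]
  have M': "M \<le> card ?J'"
    by (rule M[OF rect_cover_delete[OF cov]])
  have "card {j \<in> J. i \<in> A j} + card ?J' = card ({j \<in> J. i \<in> A j} \<union> ?J')"
    by (rule card_Un_disjoint[symmetric]) (use fin in auto)
  also have "\<dots> \<le> card J"
    by (rule card_mono) (use fin in auto)
  finally show "card {j \<in> J. i \<in> A j} + M \<le> card J"
    using M' by linarith
  assume s: "s \<in> J" "A s = {}" "B s = {i}"
  have "card {j \<in> J. i \<in> A j} + card ?J' + 1 = card (insert s ({j \<in> J. i \<in> A j} \<union> ?J'))"
    by (subst card_insert_disjoint)
       (use fin s in \<open>auto intro!: card_Un_disjoint[symmetric]\<close>)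
  also have "\<dots> \<le> card J"
    by (rule card_mono) (use fin s in auto)
  finally show "card {j \<in> J. i \<in> A j} + M + 1 \<le> card J"
    using M' by linarith
qed

text \<open>The facet \<open>x_i = 1\<close> is a hypersimplex with parameter \<open>k - 1\<close>;
  passing to it is deletion conjugated by duality.\<close>

lemma rect_cover_contract_bound:
  fixes J :: "'j set"
  assumes cov: "rect_cover X k J A B" and "i \<in> X" "0 < k" "k \<le> card X"
    and M: "\<And>(J' :: 'j set) A' B'. rect_cover (X - {i}) (k - 1) J' A' B' \<Longrightarrow> M \<le> card J'"
  shows "card {j \<in> J. i \<in> B j} + M \<le> card J"
    and "s \<in> J \<Longrightarrow> A s = {i} \<Longrightarrow> B s = {} \<Longrightarrow> card {j \<in> J. i \<in> B j} + M + 1 \<le> card J"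
proof -
  have dual: "rect_cover X (card X - k) J B A"
    by (rule rect_cover_dual[OF cov assms(4)])
  have card: "card (X - {i}) = card X - 1"
    using assms(2) rect_cover_finite(1)[OF cov] by (simp add: card_Diff_singleton)
  have M': "M \<le> card J'" if "rect_cover (X - {i}) (card X - k) J' A' B'" for J' :: "'j set" and A' B'
  proof -
    have "rect_cover (X - {i}) (card (X - {i}) - (card X - k)) J' B' A'"
      by (rule rect_cover_dual[OF that]) (use card assms(3) in simp)
    moreover have "card (X - {i}) - (card X - k) = k - 1"
      using card assms(3,4) by simp
    ultimately show ?thesis
      using M by simp
  qed
  show "card {j \<in> J. i \<in> B j} + M \<le> card J"
    by (rule rect_cover_delete_bound(1)[OF dual M'])
  show "card {j \<in> J. i \<in> B j} + M + 1 \<le> card J" if "s \<in> J" "A s = {i}" "B s = {}"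
    by (rule rect_cover_delete_bound(2)[OF dual M']) (use that in auto)
qed

text \<open>\<open>T\<close> is what the column must contain and \<open>X - U\<close> what it must
  avoid. Later, \<open>T\<close> and \<open>U\<close> are chosen so that a suspected small family of
  rectangles on the row \<open>x_i = 0\<close> would leave such a column uncovered.\<close>

lemma rect_cover_row:
  assumes cov: "rect_cover X k J A B"
    and "i \<in> T" "T \<subseteq> U" "U \<subseteq> X" "card T \<le> k" "k \<le> card U"
  shows "\<exists>j\<in>J. i \<in> A j \<and> A j \<subseteq> U \<and> B j \<inter> T = {}"
proof -
  have "finite U"
    using assms(4) rect_cover_finite(1)[OF cov] finite_subset by blast
  then obtain S where S: "T \<subseteq> S" "S \<subseteq> U" "card S = k"
    using exists_subset_between[OF assms(5,6,3)] by blast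
  then obtain j where "j \<in> J" "i \<in> A j" "A j \<subseteq> S" "B j \<inter> S = {}"
    using rect_cover_in[OF cov, of S i] assms(2,4) by blast
  with S show ?thesis by blast
qed

lemma rect_cover_row_pos:
  assumes "rect_cover X k J A B" "i \<in> X" "0 < k" "k \<le> card X"
  shows "0 < card {j \<in> J. i \<in> A j}"
proof -
  obtain j where "j \<in> J" "i \<in> A j"
    using rect_cover_row[OF assms(1), of i "{i}" X] assms(2-) by auto
  then show ?thesis
    using rect_cover_finite(2)[OF assms(1)] by (auto simp: card_gt_0_iff)
qed

text \<open>A lone rectangle on the row \<open>x_i = 0\<close> must accept every column containing
  \<open>i\<close>. As \<open>k < card X\<close>, one of them avoids a given \<open>l\<close> other
  than \<open>i\<close>, so \<open>l\<close> is not in \<open>A j\<close>; as \<open>k\<close> is at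
  least 2, one of them contains \<open>i\<close> and \<open>l\<close>, so \<open>l\<close> is not in
  \<open>B j\<close>.\<close>

lemma rect_cover_singleton:
  assumes cov: "rect_cover X k J A B" and "i \<in> X" "2 \<le> k" "k < card X"
    and j: "{j \<in> J. i \<in> A j} = {j}"
  shows "j \<in> J" "A j = {i}" "B j = {}"
proof -
  note fin = rect_cover_finite(1)[OF cov]
  have j': "j \<in> J" "i \<in> A j" using j by auto
  then show "j \<in> J" by blast
  have "l \<notin> A j" if "l \<in> X" "l \<noteq> i" for l
  proof -
    have "k \<le> card (X - {l})"
      using that(1) assms(4) fin by (simp add: card_Diff_singleton)
    then show ?thesis
      using rect_cover_row[OF cov, of i "{i}" "X - {l}"] that assms(2,3) j by auto
  qed
  then show "A j = {i}"
    using rect_cover_subset(1)[OF cov j'(1)] j' by blast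
  have "l \<notin> B j" if "l \<in> X" for l
  proof -
    have "card {i, l} \<le> k"
      using assms(3) by (simp add: card_insert_if)
    then show ?thesis
      using rect_cover_row[OF cov, of i "{i, l}" X] that assms(2,4) j by auto
  qed
  then show "B j = {}"
    using rect_cover_subset(2)[OF cov j'(1)] by blast
qed

text \<open>If the row \<open>x_i = 0\<close> meets two or more rectangles, deletion loses them.
  Otherwise its only rectangle is \<open>({i}, {})\<close>, which contraction loses together with
  all rectangles on the row \<open>x_i = 1\<close>: at least three if that row meets two. If it
  meets only one, that one is \<open>({}, {i})\<close>, and deletion loses both of these single-row
  rectangles.\<close>

lemma rect_cover_step:
  fixes J :: "'j set"
  assumes cov: "rect_cover X k J A B" and i: "i \<in> X" and k: "2 \<le> k" "k + 2 \<le> card X"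
    and M: "\<And>(J' :: 'j set) A' B'. rect_cover (X - {i}) k J' A' B' \<Longrightarrow> M \<le> card J'"
    and M': "\<And>(J' :: 'j set) A' B'. rect_cover (X - {i}) (k - 1) J' A' B' \<Longrightarrow> M' \<le> card J'"
  shows "min (M + 2) (M' + 3) \<le> card J"
proof -
  have del: "card {j \<in> J. i \<in> A j} + M \<le> card J"
    by (rule rect_cover_delete_bound(1)[OF cov M])
  have pos: "0 < card {j \<in> J. i \<in> A j}"
    by (rule rect_cover_row_pos[OF cov i]) (use k in auto)
  show ?thesis
  proof (cases "card {j \<in> J. i \<in> A j} = 1")
    case False
    then show ?thesis using pos del by linarith
  next
    case True
    then obtain s where "{j \<in> J. i \<in> A j} = {s}"
      by (auto simp: card_1_singleton_iff)
    note s = rect_cover_singleton[OF cov i k(1) _ this]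
    have con: "card {j \<in> J. i \<in> B j} + M' + 1 \<le> card J"
      by (rule rect_cover_contract_bound(2)[OF cov i _ _ M' s]) (use k in auto)
    have dual: "rect_cover X (card X - k) J B A"
      by (rule rect_cover_dual[OF cov]) (use k in auto)
    have pos': "0 < card {j \<in> J. i \<in> B j}"
      by (rule rect_cover_row_pos[OF dual i]) (use k in auto)
    show ?thesis
    proof (cases "card {j \<in> J. i \<in> B j} = 1")
      case False
      then show ?thesis using pos' con by linarith
    next
      case T2: True
      then obtain t where "{j \<in> J. i \<in> B j} = {t}"
        by (auto simp: card_1_singleton_iff)
      note t = rect_cover_singleton[OF dual i _ _ this]
      have "card {j \<in> J. i \<in> A j} + M + 1 \<le> card J"
        by (rule rect_cover_delete_bound(2)[OF cov M t(1,3,2)]) (use k in auto)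
      then show ?thesis using True by linarith
    qed
  qed
qed

section \<open>Double counting of nonzero slack entries; \<open>fits\<close> is the column set of a
  rectangle\<close>

definition fits :: "'a set \<Rightarrow> nat \<Rightarrow> 'a set \<Rightarrow> 'a set \<Rightarrow> 'a set set" where
  "fits X k C D = {S. S \<subseteq> X \<and> card S = k \<and> C \<subseteq> S \<and> D \<inter> S = {}}"

lemma finite_fits: "finite X \<Longrightarrow> finite (fits X k C D)"
  unfolding fits_def by (rule finite_subset[of _ "Pow X"]) auto

lemma fits_nonempty_card:
  assumes "finite X" "C \<subseteq> X" "D \<subseteq> X" "fits X k C D \<noteq> {}"
  shows "C \<inter> D = {}" "card C \<le> k" "card D \<le> card X - k" "k \<le> card X"
proof -
  obtain S where S: "S \<subseteq> X" "card S = k" "C \<subseteq> S" "D \<inter> S = {}"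
    using assms(4) unfolding fits_def by blast
  have fS: "finite S" using S(1) assms(1) by (rule finite_subset)
  show "C \<inter> D = {}" using S by blast
  show "card C \<le> k" using card_mono[OF fS S(3)] S(2) by simp
  show "k \<le> card X" using card_mono[OF assms(1) S(1)] S(2) by simp
  have "card D \<le> card (X - S)"
    by (rule card_mono) (use assms S in auto)
  then show "card D \<le> card X - k"
    using S fS by (simp add: card_Diff_subset)
qed

lemma card_fits_le:
  assumes X: "finite X" and C: "C \<subseteq> X" and D: "D \<subseteq> X"
    and "C \<inter> D = {}"
  shows "card (fits X k C D) \<le> (card X - card C - card D) choose (k - card C)"
proof -
  have fin: "finite C" "finite D" using assms finite_subset by blast+
  let ?Y = "X - (C \<union> D)"
  have cY: "card ?Y = card X - card C - card D"
  proof -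
    have "card ?Y = card X - card (C \<union> D)"
      by (rule card_Diff_subset) (use fin assms in auto)
    then show ?thesis using card_Un_disjoint[OF fin assms(4)] by simp
  qed
  have "inj_on (\<lambda>S. S - C) (fits X k C D)"
    by (rule inj_onI) (auto simp: fits_def)
  moreover have "(\<lambda>S. S - C) ` fits X k C D \<subseteq> {T. T \<subseteq> ?Y \<and> card T = k - card C}"
    using fin by (auto simp: fits_def card_Diff_subset)
  moreover have "finite {T. T \<subseteq> ?Y \<and> card T = k - card C}"
    by (rule finite_subset[of _ "Pow ?Y"]) (use X in auto)
  ultimately have "card (fits X k C D) \<le> card {T. T \<subseteq> ?Y \<and> card T = k - card C}"
    by (rule card_inj_on_le)
  also have "\<dots> = (card X - card C - card D) choose (k - card C)"
    using n_subsets[of ?Y] X cY by simp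
  finally show ?thesis .
qed

text \<open>The left side counts the nonzero entries of the rows \<open>x_i = 1\<close>, that is,
  the pairs \<open>(S, i)\<close> with \<open>i\<close> outside \<open>S\<close>. Each lies in a
  rectangle, whose share is its number of columns times its number of such rows.\<close>

lemma rect_cover_count_out:
  assumes cov: "rect_cover X k J A B"
  shows "(card X choose k) * (card X - k) \<le> (\<Sum>j\<in>J. card (fits X k (A j) (B j)) * card (B j))"
proof -
  note fin = rect_cover_finite[OF cov]
  have finB: "finite (B j)" if "j \<in> J" for j
    using rect_cover_subset(2)[OF cov that] fin(1) finite_subset by blast
  let ?K = "{S. S \<subseteq> X \<and> card S = k}"
  have finK: "finite ?K"
    by (rule finite_subset[of _ "Pow X"]) (use fin in auto)
  have "(card X choose k) * (card X - k) = (\<Sum>S\<in>?K. card X - k)"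
    using n_subsets[OF fin(1)] by simp
  also have "\<dots> = (\<Sum>S\<in>?K. card (X - S))"
    using fin(1) by (intro sum.cong) (auto simp: card_Diff_subset finite_subset)
  also have "\<dots> = card (Sigma ?K (\<lambda>S. X - S))"
    using finK fin(1) by simp
  also have "\<dots> \<le> card (\<Union>j\<in>J. fits X k (A j) (B j) \<times> B j)"
  proof (rule card_mono)
    show "finite (\<Union>j\<in>J. fits X k (A j) (B j) \<times> B j)"
      using fin finB by (auto intro!: finite_cartesian_product finite_fits)
    show "Sigma ?K (\<lambda>S. X - S) \<subseteq> (\<Union>j\<in>J. fits X k (A j) (B j) \<times> B j)"
    proof safe
      fix S i assume "S \<subseteq> X" "k = card S" "i \<in> X" "i \<notin> S"
      then obtain j where "j \<in> J" "i \<in> B j" "A j \<subseteq> S" "B j \<inter> S = {}"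
        using rect_cover_out[OF cov, of S i] by auto
      then show "(S, i) \<in> (\<Union>j\<in>J. fits X (card S) (A j) (B j) \<times> B j)"
        using \<open>S \<subseteq> X\<close> unfolding fits_def by blast
    qed
  qed
  also have "\<dots> \<le> (\<Sum>j\<in>J. card (fits X k (A j) (B j) \<times> B j))"
    by (rule card_UN_le[OF fin(2)])
  finally show ?thesis
    by (simp add: card_cartesian_product)
qed

lemma card_fits_dual:
  assumes "finite X" "k \<le> card X"
    and "C \<subseteq> X" "D \<subseteq> X"
  shows "card (fits X (card X - k) D C) = card (fits X k C D)"
proof (rule bij_betw_same_card[of "\<lambda>S. X - S"])
  show "bij_betw (\<lambda>S. X - S) (fits X (card X - k) D C) (fits X k C D)"
    by (rule bij_betw_byWitness[where f' = "\<lambda>S. X - S"])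
       (use assms in \<open>auto simp: fits_def card_Diff_subset finite_subset double_diff\<close>)
qed

lemma rect_cover_count_in:
  assumes cov: "rect_cover X k J A B" and k: "k \<le> card X"
  shows "(card X choose k) * k \<le> (\<Sum>j\<in>J. card (fits X k (A j) (B j)) * card (A j))"
proof -
  have "(card X choose (card X - k)) * (card X - (card X - k))
      \<le> (\<Sum>j\<in>J. card (fits X (card X - k) (B j) (A j)) * card (A j))"
    by (rule rect_cover_count_out[OF rect_cover_dual[OF cov k]])
  also have "\<dots> = (\<Sum>j\<in>J. card (fits X k (A j) (B j)) * card (A j))"
    using card_fits_dual[OF rect_cover_finite(1)[OF cov] k] rect_cover_subset[OF cov]
    by (intro sum.cong) auto
  finally show ?thesis
    using k by (simp add: binomial_symmetric[symmetric])
qed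

section \<open>Small cases\<close>

lemma rect_cover_4_2:
  assumes cov: "rect_cover X 2 J A B" and X: "card X = 4"
  shows "6 \<le> card J"
proof -
  note fin = rect_cover_finite[OF cov]
  \<comment> \<open>With \<open>a\<close> rows \<open>x_i = 0\<close> and \<open>b\<close> rows
    \<open>x_i = 1\<close> there are at most \<open>(4 - a - b) choose (2 - a)\<close> columns,
    which gives at most 4 entries whenever \<open>a\<close> and \<open>b\<close> are at most 2. In
    all, \<open>6 * 2 + 6 * 2 = 24\<close> entries must be covered.\<close>
  have le: "card (fits X 2 (A j) (B j)) * card (A j) + card (fits X 2 (A j) (B j)) * card (B j) \<le> 4"
    if j: "j \<in> J" for j
  proof (cases "fits X 2 (A j) (B j) = {}")
    case False
    note sub = rect_cover_subset[OF cov j]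
    note * = fits_nonempty_card[OF fin(1) sub False]
    have "card (fits X 2 (A j) (B j)) \<le> (4 - card (A j) - card (B j)) choose (2 - card (A j))"
      using card_fits_le[OF fin(1) sub *(1)] X by simp
    moreover have "card (A j) \<in> {0,1,2}" "card (B j) \<in> {0,1,2}"
      using *(2,3) X by auto
    ultimately show ?thesis
      by (auto simp: numeral_eq_Suc)
  qed simp
  have six: "4 choose 2 = (6::nat)" by (simp add: choose_two)
  have "24 \<le> (\<Sum>j\<in>J. card (fits X 2 (A j) (B j)) * card (A j) + card (fits X 2 (A j) (B j)) * card (B j))"
    using rect_cover_count_out[OF cov] rect_cover_count_in[OF cov] X
    by (simp add: sum.distrib six)
  also have "\<dots> \<le> (\<Sum>j\<in>J. 4)"
    by (rule sum_mono) (rule le)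
  finally show ?thesis by simp
qed


lemma rect_cover_5_2:
  assumes cov: "rect_cover X 2 J A B" and X: "card X = 5"
  shows "9 \<le> card J"
proof (rule ccontr)
  assume "\<not> 9 \<le> card J"
  then have J: "card J \<le> 8" by simp
  note fin = rect_cover_finite[OF cov]
  have finA: "finite (A j)" if "j \<in> J" for j
    using rect_cover_subset(1)[OF cov that] fin(1) finite_subset by blast
  define f where "f j = card (fits X 2 (A j) (B j)) * card (B j)" for j
  \<comment> \<open>\<open>f j\<close> counts the entries of the rows \<open>x\<^sub>i = 1\<close> in rectangle \<open>j\<close>. There are 30 of them, so
     8 rectangles would have \<open>w\<close> sum to at least -18, while spreading \<open>w j\<close> over \<open>A j\<close> leaves at most -4
     for each of the 5 indices.\<close>
  define w where "w j = real (f j) - 6" for j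
  have f_cases: "f j = 0 \<or> card (A j) \<in> {0,1,2} \<and> card (B j) \<in> {0,1,2,3} \<and>
      f j \<le> ((5 - card (A j) - card (B j)) choose (2 - card (A j))) * card (B j)"
    if j: "j \<in> J" for j
  proof (cases "fits X 2 (A j) (B j) = {}")
    case False
    note sub = rect_cover_subset[OF cov j]
    note * = fits_nonempty_card[OF fin(1) sub False]
    have "f j \<le> ((5 - card (A j) - card (B j)) choose (2 - card (A j))) * card (B j)"
      unfolding f_def using card_fits_le[OF fin(1) sub *(1)] X by simp
    moreover have "card (A j) \<in> {0,1,2}" "card (B j) \<in> {0,1,2,3}"
      using *(2,3) X by auto
    ultimately show ?thesis by blast
  qed (simp add: f_def)
  have f6: "f j \<le> 6" if "j \<in> J" for j
    using f_cases[OF that] by (auto simp: numeral_eq_Suc)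
  have fA: "f j + card (A j) \<le> 6" if "j \<in> J" "A j \<noteq> {}" for j
  proof -
    \<comment> \<open>Needed when \<open>f j = 0\<close>, where \<open>f_cases\<close> gives no
      information on \<open>A j\<close>.\<close>
    have "card (A j) \<le> 5"
      using card_mono[OF fin(1) rect_cover_subset(1)[OF cov that(1)]] X by simp
    then show ?thesis
      using f_cases[OF that(1)] finA[OF that(1)] that(2) by (auto simp: numeral_eq_Suc)
  qed
  have f4: "f j \<le> 4" if "j \<in> J" "A j = {i}" for i j
    using f_cases[OF that(1)] that(2) by (auto simp: numeral_eq_Suc)
  have f3: "f j \<le> 3" if "j \<in> J" "A j = {i}" "card (B j) \<le> 1" for i j
    using f_cases[OF that(1)] that(2,3) by (auto simp: numeral_eq_Suc)
  have row: "(\<Sum>j | j \<in> J \<and> i \<in> A j. w j / card (A j)) \<le> -4" if i: "i \<in> X" for i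
  proof -
    have cX: "card (X - {i}) = 4"
      using i X fin(1) by (simp add: card_Diff_singleton)
    have "card {j \<in> J. i \<in> A j} + 6 \<le> card J"
      by (rule rect_cover_delete_bound(1)[OF cov rect_cover_4_2[OF _ cX]])
    moreover have "0 < card {j \<in> J. i \<in> A j}"
      by (rule rect_cover_row_pos[OF cov i]) (use X in auto)
    ultimately consider "card {j \<in> J. i \<in> A j} = 1" | "card {j \<in> J. i \<in> A j} = 2"
      using J by linarith
    then show ?thesis
    proof cases
      case 1
      then obtain s where s: "{j \<in> J. i \<in> A j} = {s}"
        by (auto simp: card_1_singleton_iff)
      have "A s = {i}" "B s = {}"
        using rect_cover_singleton[OF cov i _ _ s] X by auto
      then show ?thesis
        unfolding s by (simp add: w_def f_def)
    next
      case 2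
      then obtain s t where st: "{j \<in> J. i \<in> A j} = {s, t}" "s \<noteq> t"
        by (auto simp: card_2_iff)
      \<comment> \<open>Once \<open>A s\<close> contains some \<open>x\<close> other than
        \<open>i\<close>, the columns \<open>{i, l}\<close> with \<open>l\<close> different from
        \<open>x\<close> are all left to \<open>t\<close>. This forces \<open>A t = {i}\<close> and
        \<open>B t\<close> inside \<open>{x}\<close>, so \<open>t\<close> contributes at most -3,
        and \<open>s\<close> at most -1 by \<open>fA\<close>.\<close>
      have two: "w s / card (A s) + w t / card (A t) \<le> -4"
        if st: "{j \<in> J. i \<in> A j} = {s, t}" and x: "x \<in> A s" "x \<noteq> i" for s t x
      proof -
        have sJ: "s \<in> J" "t \<in> J" "i \<in> A s" "i \<in> A t" using st by auto
        have t: "A t \<subseteq> {i, l} \<and> l \<notin> B t" if l: "l \<in> X" "l \<noteq> i" "l \<noteq> x" for l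
        proof -
          have "card {i, l} = 2" using l by auto
          then obtain j where "j \<in> J" "i \<in> A j" "A j \<subseteq> {i, l}" "B j \<inter> {i, l} = {}"
            using rect_cover_row[OF cov, of i "{i, l}" "{i, l}"] l i by auto
          moreover from this have "j \<in> {s, t}" using st by blast
          ultimately show ?thesis using x l by blast
        qed
        have "x \<in> X" using x sJ rect_cover_subset(1)[OF cov] by blast
        then have "card (X - {i, x}) = 3"
          using i x X fin(1) by (simp add: card_Diff_subset)
        then obtain l m where lm: "l \<in> X - {i, x}" "m \<in> X - {i, x}" "l \<noteq> m"
          by (auto simp: card_Suc_eq numeral_3_eq_3)
        then have At: "A t = {i}"
          using t[of l] t[of m] sJ by blast
        have "i \<notin> B t"
        proof -
          have "card {i, l} = 2" using lm by auto
          then obtain j where "j \<in> J" "i \<in> A j" "A j \<subseteq> {i, l}" "B j \<inter> {i, l} = {}"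
            using rect_cover_row[OF cov, of i "{i, l}" "{i, l}"] lm i by auto
          moreover from this have "j \<in> {s, t}" using st by blast
          ultimately show ?thesis using x lm by blast
        qed
        then have "B t \<subseteq> {x}"
          using t rect_cover_subset(2)[OF cov sJ(2)] by blast
        then have "card (B t) \<le> 1"
          using card_mono[of "{x}" "B t"] by simp
        then have "w t \<le> -3"
          using f3[OF sJ(2) At] by (simp add: w_def)
        moreover have "w s / card (A s) \<le> -1"
        proof -
          have "0 < card (A s)" using finA sJ by (auto simp: card_gt_0_iff)
          moreover have "w s \<le> - real (card (A s))"
            using fA[OF sJ(1)] sJ(3) unfolding w_def by force
          ultimately show ?thesis by (simp add: field_simps)
        qed
        ultimately show ?thesis using At by simp
      qed
      have sJ: "s \<in> J" "t \<in> J" "i \<in> A s" "i \<in> A t" using st by auto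
      have "w s / card (A s) + w t / card (A t) \<le> -4"
      proof (cases "A s = {i} \<and> A t = {i}")
        case True
        then show ?thesis
          using f4[OF sJ(1)] f4[OF sJ(2)] by (auto simp: w_def)
      next
        case False
        then obtain x where "x \<noteq> i" "x \<in> A s \<or> x \<in> A t"
          using sJ by blast
        moreover have "{j \<in> J. i \<in> A j} = {t, s}" using st by blast
        ultimately show ?thesis
          using two[of s t x] two[of t s x] st(1) by auto
      qed
      then show ?thesis
        unfolding st(1) using st(2) by simp
    qed
  qed
  have ten: "5 choose 2 = (10::nat)" by (simp add: choose_two)
  have "30 \<le> (\<Sum>j\<in>J. f j)"
    using rect_cover_count_out[OF cov] X by (simp add: f_def ten)
  then have "30 \<le> real (\<Sum>j\<in>J. f j)"
    by linarith
  moreover have "real (\<Sum>j\<in>J. f j) - 6 * real (card J) = (\<Sum>j\<in>J. w j)"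
    by (simp add: w_def sum_subtractf)
  ultimately have "-18 \<le> (\<Sum>j\<in>J. w j)"
    using J by linarith
  \<comment> \<open>Equality for nonempty \<open>A j\<close>; for empty \<open>A j\<close> the inner
    sum is 0, while \<open>w j\<close> is not positive by \<open>f6\<close>.\<close>
  also have "\<dots> \<le> (\<Sum>j\<in>J. \<Sum>i\<in>A j. w j / card (A j))"
    by (rule sum_mono) (use finA f6 in \<open>force simp: w_def\<close>)
  also have "\<dots> = (\<Sum>j\<in>J. \<Sum>i | i \<in> X \<and> i \<in> A j. w j / card (A j))"
    by (intro sum.cong) (use rect_cover_subset(1)[OF cov] in auto)
  also have "\<dots> = (\<Sum>i\<in>X. \<Sum>j | j \<in> J \<and> i \<in> A j. w j / card (A j))"
    by (rule sum.swap_restrict[OF fin(2,1)])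
  also have "\<dots> \<le> (\<Sum>i\<in>X. -4)"
    by (rule sum_mono) (rule row)
  finally show False using X by simp
qed

text \<open>With at most 10 rectangles, the bound 9 on the facets leaves one rectangle
  \<open>({i}, {})\<close> for each row \<open>x_i = 0\<close>. So at most 4 rectangles remain for
  all the rows \<open>x_i = 1\<close>, and some 2-set meets the second component of each of
  them.\<close>

lemma rect_cover_6_2:
  assumes cov: "rect_cover X 2 J A B" and X: "card X = 6"
  shows "11 \<le> card J"
proof (rule ccontr)
  assume "\<not> 11 \<le> card J"
  then have J: "card J \<le> 10" by simp
  note fin = rect_cover_finite[OF cov]
  have cX: "card (X - {i}) = 5" if "i \<in> X" for i
    using that X fin(1) by (simp add: card_Diff_singleton)
  have one: "card {j \<in> J. i \<in> A j} = 1" if i: "i \<in> X" for i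
  proof -
    have "card {j \<in> J. i \<in> A j} + 9 \<le> card J"
      by (rule rect_cover_delete_bound(1)[OF cov rect_cover_5_2[OF _ cX[OF i]]])
    moreover have "0 < card {j \<in> J. i \<in> A j}"
      by (rule rect_cover_row_pos[OF cov i]) (use X in auto)
    ultimately show ?thesis using J by linarith
  qed
  have single: "A j = {i} \<and> B j = {}" if j: "j \<in> J" "i \<in> A j" for i j
  proof -
    have i: "i \<in> X" using j rect_cover_subset(1)[OF cov] by blast
    obtain s where s: "{j \<in> J. i \<in> A j} = {s}"
      using one[OF i] by (auto simp: card_1_singleton_iff)
    have "j \<in> {s}" unfolding s[symmetric] using j by simp
    then have "s = j" by simp
    then show ?thesis
      using rect_cover_singleton[OF cov i _ _ s] X by auto
  qed
  define K where "K = {j \<in> J. B j \<noteq> {}}"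
  have finK: "finite K" unfolding K_def using fin by simp
  have AK: "A j = {}" if "j \<in> K" for j
    using single that unfolding K_def by blast
  have "card K \<le> 4"
  proof -
    have "A ` (J - K) \<supseteq> (\<lambda>i. {i}) ` X"
    proof safe
      fix i assume "i \<in> X"
      then obtain j where "j \<in> J" "i \<in> A j"
        using one[of i] by (auto simp: card_1_singleton_iff)
      then show "{i} \<in> A ` (J - K)"
        using single[of j i] unfolding K_def by force
    qed
    then have "card ((\<lambda>i. {i}) ` X) \<le> card (J - K)"
      using surj_card_le[of "J - K" _ A] fin(2) by auto
    moreover have "card ((\<lambda>i. {i}) ` X) = 6"
      using X by (simp add: card_image)
    moreover have "card (J - K) = card J - card K"
      by (rule card_Diff_subset[OF finK]) (auto simp: K_def)
    ultimately show ?thesis using J by linarith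
  qed
  have out: "\<exists>j\<in>K. i \<in> B j \<and> B j \<inter> S = {}" if "S \<subseteq> X" "card S = 2" "i \<in> X" "i \<notin> S" for S i
    using rect_cover_out[OF cov that(1,2), of i] that unfolding K_def by blast
  \<comment> \<open>Deletion would discard \<open>j\<close> as well as \<open>({i}, {})\<close>,
    giving \<open>1 + 9 + 1 = 11\<close> rectangles.\<close>
  have nosingle: "B j \<noteq> {i}" if j: "j \<in> K" "i \<in> X" for i j
  proof
    assume "B j = {i}"
    moreover have "j \<in> J" using j by (simp add: K_def)
    ultimately have "card {j \<in> J. i \<in> A j} + 9 + 1 \<le> card J"
      by (intro rect_cover_delete_bound(2)[OF cov rect_cover_5_2[OF _ cX[OF j(2)]]])
         (use AK j in auto)
    then show False using one[OF j(2)] J by simp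
  qed
  \<comment> \<open>The sets \<open>{j \<in> K. i \<in> B j}\<close> form a family of 6 sets on at most 4 points in which no set
     is covered by two others.\<close>
  have three: "3 \<le> card {j \<in> K. i \<in> B j}" if i: "i \<in> X" for i
  proof (rule ccontr)
    assume "\<not> 3 \<le> card {j \<in> K. i \<in> B j}"
    then have le: "card {j \<in> K. i \<in> B j} \<le> 2" by simp
    \<comment> \<open>Picking one further element from each of at most two sets \<open>B j\<close>
      containing \<open>i\<close> yields a 2-set \<open>S\<close> that excludes all rectangles on
      the row \<open>x_i = 1\<close>.\<close>
    have "\<exists>l. l \<in> B j \<and> l \<noteq> i" if "j \<in> K" "i \<in> B j" for j
      using nosingle[OF that(1) i] that(2) by blast
    then obtain g where g: "g j \<in> B j" "g j \<noteq> i" if "j \<in> K" "i \<in> B j" for j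
      by metis
    let ?T = "g ` {j \<in> K. i \<in> B j}"
    have "card ?T \<le> 2"
      using card_image_le[of "{j \<in> K. i \<in> B j}" g] finK le by simp
    moreover have "?T \<subseteq> X - {i}"
      using g rect_cover_subset(2)[OF cov] unfolding K_def by blast
    ultimately obtain S where S: "?T \<subseteq> S" "S \<subseteq> X - {i}" "card S = 2"
      using exists_subset_between[of ?T 2 "X - {i}"] fin(1) cX[OF i] by auto
    then obtain j where "j \<in> K" "i \<in> B j" "B j \<inter> S = {}"
      using out[of S i] i by blast
    then show False using g[of j] S(1) by blast
  qed
  obtain s where s: "s \<in> X" using X by fastforce
  have miss: "card {j \<in> K. s \<notin> B j} \<le> 1"
  proof -
    have "card {j \<in> K. s \<in> B j} + card {j \<in> K. s \<notin> B j} = card K"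
    proof (subst card_Un_disjoint[symmetric])
      show "card ({j \<in> K. s \<in> B j} \<union> {j \<in> K. s \<notin> B j}) = card K"
        by (rule arg_cong[where f = card]) blast
    qed (use finK in auto)
    then show ?thesis using three[OF s] \<open>card K \<le> 4\<close> by linarith
  qed
  \<comment> \<open>\<open>t\<close> is taken from the only set \<open>B j\<close> that may miss
    \<open>s\<close>, so \<open>{s, t}\<close> meets \<open>B j\<close> for every \<open>j\<close>
    in \<open>K\<close>.\<close>
  obtain t where t: "t \<in> X" "t \<noteq> s" "\<And>j. j \<in> K \<Longrightarrow> s \<notin> B j \<Longrightarrow> t \<in> B j"
  proof (cases "{j \<in> K. s \<notin> B j} = {}")
    case True
    have "X - {s} \<noteq> {}" using cX[OF s] by fastforce
    then show ?thesis using True that by blast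
  next
    case False
    moreover have "finite {j \<in> K. s \<notin> B j}" using finK by simp
    ultimately have "0 < card {j \<in> K. s \<notin> B j}"
      by (simp only: card_gt_0_iff not_False_eq_True simp_thms)
    then have "card {j \<in> K. s \<notin> B j} = 1" using miss by linarith
    then obtain j where j: "{j \<in> K. s \<notin> B j} = {j}"
      by (rule card_1_singletonE)
    then have j': "j \<in> K" "s \<notin> B j" by blast+
    then have "B j \<noteq> {}" "B j \<subseteq> X"
      using rect_cover_subset(2)[OF cov] unfolding K_def by blast+
    then obtain t where t: "t \<in> B j" "t \<in> X" by blast
    have "t \<in> B j'" if "j' \<in> K" "s \<notin> B j'" for j'
    proof -
      have "j' \<in> {j}" unfolding j[symmetric] using that by simp
      then show ?thesis using t(1) by simp
    qed
    moreover have "t \<noteq> s"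
      using t j' by auto
    ultimately show ?thesis using that[of t] t(2) by blast
  qed
  have "card (X - {s, t}) = 4"
    using X s t fin(1) by (simp add: card_Diff_subset)
  then have "X - {s, t} \<noteq> {}" by (metis card.empty zero_neq_numeral)
  then obtain i where "i \<in> X - {s, t}" by blast
  then show False
    using out[of "{s, t}" i] s t by auto
qed

text \<open>Each rectangle shares a unit weight equally among its rows. A rectangle
  \<open>({i}, {})\<close> gives the row its full weight; failing that, the row meets exactly two
  rectangles, and each turns out to have at most two rows.\<close>

lemma rect_cover_6_3_row:
  assumes cov: "rect_cover X 3 J A B" and X: "card X = 6" and i: "i \<in> X"
    and le: "card {j \<in> J. i \<in> A j} \<le> 2"
  shows "1 \<le> (\<Sum>j | j \<in> J \<and> i \<in> A j. 1 / real (card (A j) + card (B j)))"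
proof -
  note fin = rect_cover_finite[OF cov]
  let ?r = "\<lambda>j. 1 / real (card (A j) + card (B j))"
  have finR: "finite {j \<in> J. i \<in> A j}" using fin by simp
  have ge: "?r s \<le> (\<Sum>j | j \<in> J \<and> i \<in> A j. ?r j)" if "s \<in> J" "i \<in> A s" for s
    by (rule member_le_sum) (use that finR in auto)
  show ?thesis
  proof (cases "\<exists>s\<in>J. A s = {i} \<and> B s = {}")
    case True
    then obtain s where "s \<in> J" "A s = {i}" "B s = {}" by blast
    then show ?thesis using ge[of s] by simp
  next
    case False
    have "0 < card {j \<in> J. i \<in> A j}"
      by (rule rect_cover_row_pos[OF cov i]) (use X in auto)
    moreover have "card {j \<in> J. i \<in> A j} \<noteq> 1"
    proof
      assume "card {j \<in> J. i \<in> A j} = 1"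
      then obtain s where s: "{j \<in> J. i \<in> A j} = {s}"
        by (auto simp: card_1_singleton_iff)
      show False
        using rect_cover_singleton[OF cov i _ _ s] X False by simp
    qed
    ultimately have "card {j \<in> J. i \<in> A j} = 2" using le by linarith
    then obtain s t where st: "{j \<in> J. i \<in> A j} = {s, t}" "s \<noteq> t"
      by (auto simp: card_2_iff)
    have sJ: "s \<in> J" "t \<in> J" "i \<in> A s" "i \<in> A t" using st by auto
    have row: "(A s \<subseteq> U \<and> B s \<inter> T = {}) \<or> (A t \<subseteq> U \<and> B t \<inter> T = {})"
      if "i \<in> T" "T \<subseteq> U" "U \<subseteq> X" "card T \<le> 3" "3 \<le> card U" for T U
    proof -
      have "\<exists>j\<in>J. i \<in> A j \<and> A j \<subseteq> U \<and> B j \<inter> T = {}"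
        by (rule rect_cover_row[OF cov that])
      then obtain j where j: "j \<in> J" "i \<in> A j" "A j \<subseteq> U" "B j \<inter> T = {}"
        by blast
      then have "j \<in> {s, t}" unfolding st(1)[symmetric] by simp
      then show ?thesis using j by auto
    qed
    have sub: "A s \<subseteq> X" "A t \<subseteq> X" "B s \<subseteq> X" "B t \<subseteq> X"
      using rect_cover_subset[OF cov] sJ by auto
    \<comment> \<open>Any condition by which \<open>s\<close> excludes 3-sets containing \<open>i\<close> must contradict every such condition of \<open>t\<close>.\<close>
    have AA: "x = i \<or> y = i" if "x \<in> A s" "y \<in> A t" for x y
    proof (rule ccontr)
      assume "\<not> (x = i \<or> y = i)"
      moreover have "card X - card {x, y} \<le> card (X - {x, y})"
        by (rule diff_card_le_card_Diff) simp
      moreover have "card {x, y} \<le> 2" by (simp add: card_insert_if)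
      moreover from calculation have "3 \<le> card (X - {x, y})" using X by linarith
      ultimately show False
        using row[of "{i}" "X - {x, y}"] that i X by auto
    qed
    have BB: False if "x \<in> B s" "y \<in> B t" for x y
    proof -
      have "card {i, x, y} \<le> 3" by (simp add: card_insert_if)
      then show False
        using row[of "{i, x, y}" X] that i X sub by auto
    qed
    have AB: "x = y" if "x \<in> A p" "x \<noteq> i" "y \<in> B q" "{p, q} = {s, t}" for x y p q
    proof (rule ccontr)
      assume "x \<noteq> y"
      moreover have "y \<in> X" using that sub by (auto simp: doubleton_eq_iff)
      moreover have "card (X - {x}) \<ge> 5"
        using diff_card_le_card_Diff[of "{x}" X] X by simp
      moreover have "card {i, y} \<le> 3" by (simp add: card_insert_if)
      ultimately show False
        using row[of "{i, y}" "X - {x}"] that i by (auto simp: doubleton_eq_iff)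
    qed
    \<comment> \<open>\<open>AA\<close>, \<open>BB\<close> and \<open>AB\<close> leave only
      \<open>p = ({i, x}, {})\<close> and \<open>q = ({i}, {x})\<close>; \<open>B q\<close> is
      nonempty because \<open>({i}, {})\<close> was excluded.\<close>
    have two: "card (A p) + card (B p) \<le> 2 \<and> card (A q) + card (B q) \<le> 2"
      if pq: "{p, q} = {s, t}" and x: "x \<in> A p" "x \<noteq> i" for p q x
    proof -
      have p: "p \<in> J" "q \<in> J" "i \<in> A p" "i \<in> A q" using pq sJ by (auto simp: doubleton_eq_iff)
      have Aq: "A q = {i}"
        using AA x p pq by (auto simp: doubleton_eq_iff)
      then obtain y where y: "y \<in> B q" using False p by blast
      then have "B p = {}" using BB pq by (auto simp: doubleton_eq_iff)
      moreover have "B q \<subseteq> {x}" "A p \<subseteq> {i, x}"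
        using AB[OF _ _ _ pq] x y by blast+
      then have "card (B q) \<le> 1" "card (A p) \<le> 2"
        using card_mono[of "{x}" "B q"] card_mono[of "{i, x}" "A p"] x by auto
      ultimately show ?thesis using Aq by simp
    qed
    have "card (A s) + card (B s) \<le> 2 \<and> card (A t) + card (B t) \<le> 2"
    proof (cases "A s = {i} \<and> A t = {i}")
      case True
      then have "B s \<noteq> {}" "B t \<noteq> {}" using False sJ(1,2) by auto
      then obtain x y where "x \<in> B s" "y \<in> B t" by blast
      then show ?thesis using BB by blast
    next
      case F: False
      then obtain x where "x \<noteq> i" "x \<in> A s \<or> x \<in> A t" using sJ by blast
      then show ?thesis using two[of s t x] two[of t s x] by auto
    qed
    moreover have "0 < card (A s)" "0 < card (A t)"
      using sJ sub fin(1) by (auto simp: card_gt_0_iff finite_subset)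
    ultimately have "1 / 2 \<le> ?r s" "1 / 2 \<le> ?r t"
      by (auto simp: field_simps)
    then show ?thesis
      unfolding st(1) using st(2) by simp
  qed
qed

text \<open>Each of the 12 rows receives weight at least 1, while a rectangle gives away at most 1.
  Self-duality transfers the estimate for the rows \<open>x_i = 0\<close> to the rows
  \<open>x_i = 1\<close>.\<close>

lemma rect_cover_6_3:
  assumes cov: "rect_cover X 3 J A B" and X: "card X = 6"
  shows "12 \<le> card J"
proof (rule ccontr)
  assume "\<not> 12 \<le> card J"
  then have J: "card J \<le> 11" by simp
  note fin = rect_cover_finite[OF cov]
  let ?r = "\<lambda>j. 1 / real (card (A j) + card (B j))"
  have dual: "rect_cover X 3 J B A"
    using rect_cover_dual[OF cov] X by simp
  have cX: "card (X - {i}) = 5" if "i \<in> X" for i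
    using that X fin(1) by (simp add: card_Diff_singleton)
  \<comment> \<open>The facet \<open>x_i = 0\<close> has parameters (5,3), dual to (5,2).\<close>
  have five3: "9 \<le> card J'" if "rect_cover (X - {i}) 3 J' A' B'" "i \<in> X" for i J' A' B'
    using rect_cover_dual[OF that(1)] cX[OF that(2)] by (auto intro: rect_cover_5_2)
  have A: "1 \<le> (\<Sum>j | j \<in> J \<and> i \<in> A j. ?r j)" if i: "i \<in> X" for i
  proof (rule rect_cover_6_3_row[OF cov X i])
    have "card {j \<in> J. i \<in> A j} + 9 \<le> card J"
      by (rule rect_cover_delete_bound(1)[OF cov five3[OF _ i]])
    then show "card {j \<in> J. i \<in> A j} \<le> 2" using J by simp
  qed
  have B: "1 \<le> (\<Sum>j | j \<in> J \<and> i \<in> B j. ?r j)" if i: "i \<in> X" for i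
  proof -
    have "card {j \<in> J. i \<in> B j} + 9 \<le> card J"
      by (rule rect_cover_delete_bound(1)[OF dual five3[OF _ i]])
    then have "card {j \<in> J. i \<in> B j} \<le> 2" using J by simp
    then show ?thesis
      using rect_cover_6_3_row[OF dual X i] by (simp add: add.commute)
  qed
  have "12 = (\<Sum>i\<in>X. 1) + (\<Sum>i\<in>X. (1::real))"
    using X by simp
  also have "\<dots> \<le> (\<Sum>i\<in>X. \<Sum>j | j \<in> J \<and> i \<in> A j. ?r j) + (\<Sum>i\<in>X. \<Sum>j | j \<in> J \<and> i \<in> B j. ?r j)"
    by (intro add_mono sum_mono A B)
  also have "\<dots> = (\<Sum>j\<in>J. \<Sum>i | i \<in> X \<and> i \<in> A j. ?r j) + (\<Sum>j\<in>J. \<Sum>i | i \<in> X \<and> i \<in> B j. ?r j)"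
    by (simp only: sum.swap_restrict[OF fin(1,2)])
  also have "\<dots> = (\<Sum>j\<in>J. \<Sum>i\<in>A j. ?r j) + (\<Sum>j\<in>J. \<Sum>i\<in>B j. ?r j)"
    by (intro arg_cong2[where f = "(+)"] sum.cong) (use rect_cover_subset[OF cov] in auto)
  also have "\<dots> = (\<Sum>j\<in>J. real (card (A j) + card (B j)) * ?r j)"
    by (simp only: sum_constant sum.distrib[symmetric] of_nat_add distrib_right)
  also have "\<dots> \<le> (\<Sum>j\<in>J. 1)"
    by (rule sum_mono) simp
  finally show False using J by simp
qed

section \<open>Induction on the number of coordinates\<close>

theorem rect_cover_lower_bound:
  fixes J :: "'j set"
  assumes "rect_cover X k J A B" "card X = n" "6 \<le> n" "2 \<le> k" "2 * k \<le> n"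
  shows "(if 2 * k + 1 < n then n + 2 * k + 1 else 2 * n) \<le> card J"
  using assms(3,1,2,4,5)
proof (induction n arbitrary: X k J A B rule: dec_induct)
  case base
  then consider "k = 2" | "k = 3" by linarith
  then show ?case
    using rect_cover_6_2[of X J A B] rect_cover_6_3[of X J A B] base by cases auto
next
  case (step n)
  note cov = step.prems(1)
  note k = step.prems(3,4)
  note fin = rect_cover_finite(1)[OF cov]
  obtain i where i: "i \<in> X" using step.prems(2) by fastforce
  have cX: "card (X - {i}) = n"
    using i step.prems(2) fin by (simp add: card_Diff_singleton)
  consider "2 * k + 1 < Suc n" | "Suc n = 2 * k + 1" | "Suc n = 2 * k" using k by linarith
  then show ?case
  proof cases
    case 1
    \<comment> \<open>The bound grows by 1 here, so losing one rectangle is enough. At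
      \<open>n = 2 * k + 1\<close> the two branches of the hypothesis agree.\<close>
    have "card {j \<in> J. i \<in> A j} + (n + 2 * k + 1) \<le> card J"
    proof (rule rect_cover_delete_bound(1)[OF cov])
      fix J' :: "'j set" and A' B' assume "rect_cover (X - {i}) k J' A' B'"
      then show "n + 2 * k + 1 \<le> card J'"
        using step.IH[of "X - {i}" k J' A' B'] cX 1 k by (auto split: if_splits)
    qed
    moreover have "0 < card {j \<in> J. i \<in> A j}"
      by (rule rect_cover_row_pos[OF cov i]) (use k step.prems(2) in auto)
    ultimately show ?thesis using 1 by simp
  next
    case 2
    \<comment> \<open>Now \<open>n = 2 * k\<close>: deletion leads to the middle case with value
      \<open>2 * n\<close>, contraction to \<open>n + 2 * (k - 1) + 1\<close>. Both alternatives
      give exactly the required \<open>2 * (n + 1)\<close>.\<close>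
    have "min (4 * k + 2) (4 * k - 1 + 3) \<le> card J"
    proof (rule rect_cover_step[OF cov i])
      fix J' :: "'j set" and A' B'
      show "4 * k \<le> card J'" if "rect_cover (X - {i}) k J' A' B'"
        using step.IH[OF that cX] 2 k by auto
      show "4 * k - 1 \<le> card J'" if "rect_cover (X - {i}) (k - 1) J' A' B'"
      proof -
        have "2 \<le> k - 1" "2 * (k - 1) \<le> n" "2 * (k - 1) + 1 < n"
          "n + 2 * (k - 1) + 1 = 4 * k - 1"
          using 2 k step.hyps by auto
        then show ?thesis
          using step.IH[OF that cX] by simp
      qed
    qed (use step.prems step.hyps 2 in auto)
    then show ?thesis using 2 k by simp
  next
    case 3
    \<comment> \<open>Now \<open>n = 2 * k - 1\<close>: deletion and contraction lead to dual
      hypersimplices, both with bound \<open>2 * n\<close>.\<close>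
    have "min (2 * n + 2) (2 * n + 3) \<le> card J"
    proof (rule rect_cover_step[OF cov i])
      have G: "2 * n \<le> card J'" if "rect_cover (X - {i}) (k - 1) J' A' B'" for J' :: "'j set" and A' B'
      proof -
        have "2 \<le> k - 1" "2 * (k - 1) \<le> n" "\<not> 2 * (k - 1) + 1 < n"
          using 3 step.hyps by auto
        then show ?thesis
          using step.IH[OF that cX] by simp
      qed
      fix J' :: "'j set" and A' B'
      show "2 * n \<le> card J'" if "rect_cover (X - {i}) (k - 1) J' A' B'"
        by (rule G[OF that])
      show "2 * n \<le> card J'" if c: "rect_cover (X - {i}) k J' A' B'"
      proof (rule G)
        have "card (X - {i}) - k = k - 1" using cX 3 by simp
        then show "rect_cover (X - {i}) (k - 1) J' B' A'"
          using rect_cover_dual[OF c] cX 3 by (cases k) auto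
      qed
    qed (use step.prems step.hyps 3 in auto)
    then show ?thesis using 3 by simp
  qed
qed

section \<open>Polytopes with finitely supported coordinates\<close>

text \<open>The properties of an extension that the covering argument needs from its facets:
  finitely many, and enough of them to separate points from nonempty faces. Stated without a norm,
  so that it applies to \<open>nat \<Rightarrow>\<^sub>0 real\<close>.\<close>

definition facet_determined :: "'a::real_vector set \<Rightarrow> bool" where
  "facet_determined Q \<longleftrightarrow> finite (facets Q) \<and>
     (\<forall>E q. E face_of Q \<and> E \<noteq> {} \<and> q \<in> Q - E \<longrightarrow> (\<exists>R\<in>facets Q. E \<subseteq> R \<and> q \<notin> R))"

lemma facet_determined_euclidean:
  fixes Q :: "'a::euclidean_space set"
  assumes "polytope Q"
  shows "facet_determined Q"
  unfolding facet_determined_def facets_euclidean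
proof (intro conjI allI impI)
  show "finite {F. F facet_of Q}"
    by (rule finite_polytope_facets[OF assms])
  fix E q assume E: "E face_of Q \<and> E \<noteq> {} \<and> q \<in> Q - E"
  then have "E = \<Inter> {F. F facet_of Q \<and> E \<subseteq> F}"
    using face_of_polyhedron[OF polytope_imp_polyhedron[OF assms], of E] by blast
  with E show "\<exists>R\<in>{F. F facet_of Q}. E \<subseteq> R \<and> q \<notin> R"
    by blast
qed

lemma facet_determined_linear_image:
  fixes f :: "'a::euclidean_space \<Rightarrow> 'b::real_vector"
  assumes f: "linear f" "inj f" and Q: "facet_determined Q"
  shows "facet_determined (f ` Q)"
proof -
  have faces: "{T. T face_of f ` Q} = image f ` {T. T face_of Q}"
    by (rule faces_of_linear_image[OF f])
  have facets: "facets (f ` Q) = image f ` facets Q"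
  proof -
    have "facets (f ` Q) = {F \<in> {F. F face_of f ` Q}. F \<noteq> {} \<and> affdim (f ` Q) = affdim F + 1}"
      unfolding facets_def by blast
    also have "\<dots> = image f ` facets Q"
      unfolding faces affdim_injective_linear_image[OF f] facets_def
      by (auto simp: affdim_injective_linear_image[OF f])
    finally show ?thesis .
  qed
  show ?thesis
    unfolding facet_determined_def
  proof (intro conjI allI impI)
    show "finite (facets (f ` Q))"
      using Q unfolding facets facet_determined_def by simp
    fix E q assume E: "E face_of f ` Q \<and> E \<noteq> {} \<and> q \<in> f ` Q - E"
    then obtain E' q' where E': "E = f ` E'" "E' face_of Q" "q = f q'" "q' \<in> Q"
      using faces by blast
    then have "E' \<noteq> {}" "q' \<notin> E'" using E by auto
    then obtain R where "R \<in> facets Q" "E' \<subseteq> R" "q' \<notin> R"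
      using E' Q unfolding facet_determined_def by blast
    then have "f ` R \<in> facets (f ` Q)" "E \<subseteq> f ` R" "q \<notin> f ` R"
      using E' f(2) facets by (auto simp: inj_image_mem_iff)
    then show "\<exists>R\<in>facets (f ` Q). E \<subseteq> R \<and> q \<notin> R" by blast
  qed
qed

text \<open>Transferring a polytope in \<open>nat \<Rightarrow>\<^sub>0 real\<close> to a Euclidean space requires a type whose
  cardinality depends on the polytope, which cannot be formed inside a proof. As the transferred
  statement has no free type variables, it suffices to build that type once, for a
  hypothetical counterexample: \<open>defect_coords\<close> bounds the coordinates in which one of them lives
  (and is an unspecified number, since there is none).\<close>

definition defect_coords :: nat where
  "defect_coords = (SOME m. \<exists>V :: (nat \<Rightarrow>\<^sub>0 real) set.
     finite V \<and> \<not> facet_determined (convex hull V) \<and> (\<forall>v\<in>V. Poly_Mapping.keys v \<subseteq> {..m}))"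

typedef defect_coord = "{..defect_coords}"
  by auto

instance defect_coord :: finite
proof
  have eq: "(UNIV :: defect_coord set) = Abs_defect_coord ` {..defect_coords}"
    using type_definition.Abs_image[OF type_definition_defect_coord] by simp
  show "finite (UNIV :: defect_coord set)"
    unfolding eq by (rule finite_imageI) simp
qed

lemma facet_determined_poly_mapping:
  fixes Q :: "(nat \<Rightarrow>\<^sub>0 real) set"
  assumes "polytope Q"
  shows "facet_determined Q"
proof (rule ccontr)
  assume "\<not> facet_determined Q"
  then obtain W :: "(nat \<Rightarrow>\<^sub>0 real) set" where W: "finite W" "\<not> facet_determined (convex hull W)"
    using assms unfolding polytope_def by blast
  have "finite (\<Union>v\<in>W. Poly_Mapping.keys v)" using W(1) by simp
  then obtain m where "(\<Union>v\<in>W. Poly_Mapping.keys v) \<subseteq> {..m}"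
    using finite_nat_iff_bounded_le by blast
  then have "\<exists>m. \<exists>V :: (nat \<Rightarrow>\<^sub>0 real) set.
      finite V \<and> \<not> facet_determined (convex hull V) \<and> (\<forall>v\<in>V. Poly_Mapping.keys v \<subseteq> {..m})"
    using W by blast
  \<comment> \<open>The number \<open>defect_coords\<close> bounds the coordinates of some
    counterexample, not necessarily of \<open>W\<close>; the argument goes on with that one.\<close>
  then have "\<exists>V :: (nat \<Rightarrow>\<^sub>0 real) set.
      finite V \<and> \<not> facet_determined (convex hull V) \<and> (\<forall>v\<in>V. Poly_Mapping.keys v \<subseteq> {..defect_coords})"
    unfolding defect_coords_def by (rule someI_ex)
  then obtain V :: "(nat \<Rightarrow>\<^sub>0 real) set" where V: "finite V" "\<not> facet_determined (convex hull V)"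
    and keys: "\<And>v. v \<in> V \<Longrightarrow> Poly_Mapping.keys v \<subseteq> {..defect_coords}"
    by blast
  define f :: "real ^ defect_coord \<Rightarrow> nat \<Rightarrow>\<^sub>0 real"
    where "f x = (\<Sum>c\<in>UNIV. Poly_Mapping.single (Rep_defect_coord c) (x $ c))" for x
  define g :: "(nat \<Rightarrow>\<^sub>0 real) \<Rightarrow> real ^ defect_coord"
    where "g y = (\<chi> c. Poly_Mapping.lookup y (Rep_defect_coord c))" for y
  have lookup: "Poly_Mapping.lookup (f x) i = (\<Sum>c\<in>UNIV. if Rep_defect_coord c = i then x $ c else 0)"
    for x i
    unfolding f_def lookup_sum by (rule sum.cong) (auto simp: lookup_single when_def)
  have gf: "g (f x) = x" for x
    by (simp add: g_def lookup vec_eq_iff Rep_defect_coord_inject)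
  have fg: "f (g y) = y" if "Poly_Mapping.keys y \<subseteq> {..defect_coords}" for y
  proof (rule poly_mapping_eqI)
    fix i
    show "Poly_Mapping.lookup (f (g y)) i = Poly_Mapping.lookup y i"
    proof (cases "i \<le> defect_coords")
      case True
      then have "Rep_defect_coord c = i \<longleftrightarrow> c = Abs_defect_coord i" for c
        using Abs_defect_coord_inverse[of i] Rep_defect_coord_inverse[of c] by auto
      then show ?thesis
        using True by (simp add: lookup g_def Abs_defect_coord_inverse)
    next
      case False
      then have "Rep_defect_coord c \<noteq> i" for c
        using Rep_defect_coord[of c] by auto
      moreover have "Poly_Mapping.lookup y i = 0"
        using that False by (auto simp: in_keys_iff)
      ultimately show ?thesis by (simp add: lookup)
    qed
  qed
  have scale: "r *\<^sub>R Poly_Mapping.single i a = Poly_Mapping.single i (r * a)"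
    for r a :: real and i :: nat
    by (rule poly_mapping_eqI) (simp add: scaleR_poly_mapping_def lookup_single when_def)
  have "linear f"
    by (rule linearI) (simp_all add: f_def single_add sum.distrib scale scaleR_sum_right)
  moreover have "inj f" by (rule inj_on_inverseI[of _ g]) (rule gf)
  moreover have "polytope (convex hull (g ` V))"
    using V(1) by (simp add: polytope_convex_hull)
  ultimately have "facet_determined (f ` (convex hull (g ` V)))"
    by (intro facet_determined_linear_image facet_determined_euclidean)
  moreover have "f ` g ` V = V" using fg keys by force
  then have "f ` (convex hull (g ` V)) = convex hull V"
    using convex_hull_linear_image[OF \<open>linear f\<close>, of "g ` V"] by simp
  ultimately show False using V(2) by simp
qed

section \<open>From extensions to rectangle coverings\<close>

lemma hypersimplex_bounds:
  fixes x :: "real ^ 'n::finite"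
  assumes "x \<in> hypersimplex k"
  shows "0 \<le> x $ i" "x $ i \<le> 1" "(\<Sum>i\<in>UNIV. x $ i) = real k"
proof -
  let ?C = "{x :: real ^ 'n. (\<forall>i. 0 \<le> x $ i \<and> x $ i \<le> 1) \<and> (\<Sum>i\<in>UNIV. x $ i) = real k}"
  have "convex ?C"
  proof (rule convexI)
    fix x y :: "real ^ 'n" and u v :: real
    assume *: "x \<in> ?C" "y \<in> ?C" "0 \<le> u" "0 \<le> v" "u + v = 1"
    have "u * x $ i + v * y $ i \<le> u * 1 + v * 1" for i
      by (intro add_mono mult_left_mono) (use * in auto)
    moreover have "(\<Sum>i\<in>UNIV. u * x $ i + v * y $ i) = (u + v) * real k"
      using *(1,2) by (simp add: sum.distrib sum_distrib_left[symmetric] distrib_right)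
    ultimately show "u *\<^sub>R x + v *\<^sub>R y \<in> ?C"
      using * by simp
  qed
  then have "hypersimplex k \<subseteq> ?C"
    unfolding hypersimplex_def
  proof (rule hull_minimal[rotated], intro subsetI CollectI conjI allI)
    fix x :: "real ^ 'n" and i
    assume "x \<in> {x. (\<forall>i. x $ i \<in> {0, 1}) \<and> (\<Sum>i\<in>UNIV. x $ i) = real k}"
    then have "x $ i \<in> {0, 1}" "(\<Sum>i\<in>UNIV. x $ i) = real k" by blast+
    then show "0 \<le> x $ i" "x $ i \<le> 1" "(\<Sum>i\<in>UNIV. x $ i) = real k" by auto
  qed
  with assms show "0 \<le> x $ i" "x $ i \<le> 1" "(\<Sum>i\<in>UNIV. x $ i) = real k" by auto
qed

lemma hypersimplex_faces:
  fixes i :: "'n::finite"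
  shows "{x \<in> hypersimplex k. x $ i = 0} face_of (hypersimplex k :: (real ^ 'n) set)" (is ?zero)
    and "{x \<in> hypersimplex k. x $ i = 1} face_of (hypersimplex k :: (real ^ 'n) set)" (is ?one)
proof -
  have conv: "convex (hypersimplex k :: (real ^ 'n) set)"
    unfolding hypersimplex_def by (rule convex_convex_hull)
  have "hypersimplex k \<inter> {x. axis i 1 \<bullet> x = 0} face_of (hypersimplex k :: (real ^ 'n) set)"
    by (rule face_of_Int_supporting_hyperplane_ge[OF conv])
       (simp add: inner_axis' hypersimplex_bounds)
  then show ?zero by (simp add: inner_axis' Int_def)
  have "hypersimplex k \<inter> {x. axis i 1 \<bullet> x = 1} face_of (hypersimplex k :: (real ^ 'n) set)"
    by (rule face_of_Int_supporting_hyperplane_le[OF conv])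
       (simp add: inner_axis' hypersimplex_bounds)
  then show ?one by (simp add: inner_axis' Int_def)
qed

definition indicator_vec :: "'n::finite set \<Rightarrow> real ^ 'n" where
  "indicator_vec S = (\<chi> i. of_bool (i \<in> S))"

lemma indicator_vec_in_hypersimplex:
  "card S = k \<Longrightarrow> indicator_vec S \<in> hypersimplex k"
  unfolding hypersimplex_def indicator_vec_def by (rule hull_inc) (simp add: sum.If_cases of_bool_def)

text \<open>The functional summing the coordinates in \<open>S\<close> is at most \<open>k\<close>;
  equality forces the coordinates outside \<open>S\<close> to be 0, and then those inside to be
  1.\<close>

lemma indicator_vec_face:
  fixes S :: "'n::finite set"
  assumes S: "card S = k"
  shows "{indicator_vec S} face_of (hypersimplex k)"
proof -
  let ?H = "hypersimplex k :: (real ^ 'n) set"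
  have inner: "indicator_vec S \<bullet> x = (\<Sum>i\<in>S. x $ i)" for x :: "real ^ 'n"
    by (simp add: indicator_vec_def inner_vec_def sum.If_cases of_bool_def if_distrib
        if_distribR cong: if_cong)
  have split: "(\<Sum>i\<in>S. x $ i) + (\<Sum>i\<in>-S. x $ i) = real k" if "x \<in> ?H" for x
    using hypersimplex_bounds(3)[OF that] sum.union_disjoint[of S "-S" "\<lambda>i. x $ i"]
    by (simp add: Compl_partition)
  have "?H \<inter> {x. indicator_vec S \<bullet> x = real k} face_of ?H"
  proof (rule face_of_Int_supporting_hyperplane_le)
    show "convex ?H" unfolding hypersimplex_def by (rule convex_convex_hull)
    show "indicator_vec S \<bullet> x \<le> real k" if "x \<in> ?H" for x
      using split[OF that] sum_nonneg[of "-S" "\<lambda>i. x $ i"] hypersimplex_bounds(1)[OF that]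
      unfolding inner by simp
  qed
  moreover have "?H \<inter> {x. indicator_vec S \<bullet> x = real k} = {indicator_vec S}"
  proof (intro equalityI subsetI)
    fix x assume "x \<in> ?H \<inter> {x. indicator_vec S \<bullet> x = real k}"
    then have x: "x \<in> ?H" "(\<Sum>i\<in>S. x $ i) = real k" unfolding inner by auto
    note bounds = hypersimplex_bounds(1,2)[OF x(1)]
    have "(\<Sum>i\<in>-S. x $ i) = 0" using split[OF x(1)] x(2) by simp
    then have "x $ i = 0" if "i \<notin> S" for i
      using that bounds(1) sum_nonneg_eq_0_iff[of "-S" "\<lambda>i. x $ i"] by simp
    moreover have "(\<Sum>i\<in>S. 1 - x $ i) = 0" using x(2) S by (simp add: sum_subtractf)
    then have "x $ i = 1" if "i \<in> S" for i
      using that bounds(2) sum_nonneg_eq_0_iff[of S "\<lambda>i. 1 - x $ i"] by simp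
    ultimately show "x \<in> {indicator_vec S}"
      by (simp add: vec_eq_iff indicator_vec_def)
  next
    fix x assume "x \<in> {indicator_vec S}"
    then show "x \<in> ?H \<inter> {x. indicator_vec S \<bullet> x = real k}"
      using indicator_vec_in_hypersimplex[OF S] S unfolding inner
      by (simp add: indicator_vec_def)
  qed
  ultimately show ?thesis by simp
qed

text \<open>An affine map sends an open segment to a point or to the open segment between the images
  of its ends; in either case the ends land in \<open>F\<close>.\<close>

lemma face_of_affine_preimage:
  fixes L :: "'a::real_vector \<Rightarrow> 'b::real_vector"
  assumes "convex Q" "linear L" and F: "F face_of (\<lambda>x. L x + c) ` Q"
  shows "{x \<in> Q. L x + c \<in> F} face_of Q"
proof -
  have comb: "L ((1 - u) *\<^sub>R a + u *\<^sub>R b) + c = (1 - u) *\<^sub>R (L a + c) + u *\<^sub>R (L b + c)" for u a b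
  proof -
    have "L ((1 - u) *\<^sub>R a + u *\<^sub>R b) = (1 - u) *\<^sub>R L a + u *\<^sub>R L b"
      using assms(2) by (simp only: linear_add linear_scale)
    then show ?thesis by (simp add: algebra_simps)
  qed
  have "convex F" using F by (rule face_of_imp_convex)
  show ?thesis
    unfolding face_of_def
  proof (intro conjI ballI impI)
    show "convex {x \<in> Q. L x + c \<in> F}"
      unfolding convex_alt
    proof (intro ballI allI impI)
      fix x y and u :: real
      assume *: "x \<in> {x \<in> Q. L x + c \<in> F}" "y \<in> {x \<in> Q. L x + c \<in> F}" "0 \<le> u \<and> u \<le> 1"
      then show "(1 - u) *\<^sub>R x + u *\<^sub>R y \<in> {x \<in> Q. L x + c \<in> F}"
        using assms(1) \<open>convex F\<close> unfolding convex_alt mem_Collect_eq comb by blast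
    qed
    fix a b x
    assume ab: "a \<in> Q" "b \<in> Q" and x: "x \<in> {x \<in> Q. L x + c \<in> F}" "x \<in> open_segment a b"
    then obtain u where u: "0 < u" "u < 1" "x = (1 - u) *\<^sub>R a + u *\<^sub>R b"
      by (auto simp: in_segment)
    have "L a + c \<in> F \<and> L b + c \<in> F"
    proof (cases "L a + c = L b + c")
      case True
      then have "L x + c = L a + c"
        unfolding u(3) comb by (simp add: scaleR_left_distrib[symmetric])
      then show ?thesis using True x by simp
    next
      case False
      then have "L x + c \<in> open_segment (L a + c) (L b + c)"
        using u comb by (auto simp: in_segment)
      then show ?thesis
        using F ab x unfolding face_of_def by blast
    qed
    then show "a \<in> {x \<in> Q. L x + c \<in> F}" "b \<in> {x \<in> Q. L x + c \<in> F}" using ab by auto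
  qed auto
qed

text \<open>Only incidences of faces enter, which is why a polytope with the same face lattice as
  the hypersimplex suffices.\<close>

lemma extension_rect_cover:
  fixes P :: "'a::euclidean_space set" and Q :: "(nat \<Rightarrow>\<^sub>0 real) set"
  assumes Q: "polytope Q" "linear L" "P = (\<lambda>x. L x + c) ` Q"
    and P: "combinatorial_hypersimplex TYPE('n::finite) k P" and k: "0 < k" "k < CARD('n)"
  shows "finite (facets Q)" "\<exists>A B. rect_cover (UNIV :: 'n set) k (facets Q) A B"
proof -
  let ?H = "hypersimplex k :: (real ^ 'n) set"
  have det: "facet_determined Q"
    by (rule facet_determined_poly_mapping[OF Q(1)])
  then show fin: "finite (facets Q)"
    unfolding facet_determined_def by blast
  obtain \<phi> where bij: "bij_betw \<phi> {F. F face_of P} {G. G face_of ?H}"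
    and mono: "\<And>F F'. F face_of P \<Longrightarrow> F' face_of P \<Longrightarrow> F \<subseteq> F' \<longleftrightarrow> \<phi> F \<subseteq> \<phi> F'"
    using P unfolding combinatorial_hypersimplex_def face_lattices_isomorphic_def by blast
  define \<psi> where "\<psi> = inv_into {F. F face_of P} \<phi>"
  have \<phi>: "\<phi> F face_of ?H" if "F face_of P" for F
    using bij_betw_apply[OF bij, of F] that by simp
  have \<psi>: "\<psi> G face_of P" "\<phi> (\<psi> G) = G" if "G face_of ?H" for G
    using bij_betw_apply[OF bij_betw_inv_into[OF bij], of G] bij_betw_inv_into_right[OF bij, of G] that
    unfolding \<psi>_def by auto
  have \<psi>_mono: "\<psi> G \<subseteq> \<psi> G' \<longleftrightarrow> G \<subseteq> G'" if "G face_of ?H" "G' face_of ?H" for G G'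
    using mono[OF \<psi>(1)[OF that(1)] \<psi>(1)[OF that(2)]] \<psi>(2) that by simp
  have \<phi>_empty: "F = {}" if "F face_of P" "\<phi> F = {}" for F
  proof -
    have "\<phi> F \<subseteq> \<phi> {}" using that(2) by simp
    then show ?thesis using mono[OF that(1) empty_face_of] by simp
  qed
  define v where "v S = \<psi> {indicator_vec S}" for S :: "'n set"
  have v: "v S face_of P" "v S \<noteq> {}" if "card S = k" for S
  proof -
    show face: "v S face_of P"
      unfolding v_def by (rule \<psi>(1)[OF indicator_vec_face[OF that]])
    show "v S \<noteq> {}"
    proof
      assume "v S = {}"
      then have "v S \<subseteq> \<psi> {}" by simp
      then have "{indicator_vec S :: real ^ 'n} \<subseteq> {}"
        unfolding v_def using \<psi>_mono[OF indicator_vec_face[OF that] empty_face_of] by simp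
      then show False by simp
    qed
  qed
  \<comment> \<open>The intersection is a face whose image under \<open>\<phi>\<close> lies in both
    \<open>{indicator_vec S}\<close> and \<open>G\<close>, hence is empty.\<close>
  have disj: "v S \<inter> \<psi> G = {}" if S: "card S = k" and G: "G face_of ?H" "indicator_vec S \<notin> G" for S G
  proof (rule ccontr)
    assume ne: "v S \<inter> \<psi> G \<noteq> {}"
    have face: "v S \<inter> \<psi> G face_of P"
      by (rule face_of_Int[OF v(1)[OF S] \<psi>(1)[OF G(1)]])
    have "\<phi> (v S \<inter> \<psi> G) \<subseteq> {indicator_vec S}"
      using mono[OF face v(1)[OF S]] \<psi>(2)[OF indicator_vec_face[OF S]] unfolding v_def by simp
    moreover have "\<phi> (v S \<inter> \<psi> G) \<subseteq> G"
      using mono[OF face \<psi>(1)[OF G(1)]] \<psi>(2)[OF G(1)] by simp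
    ultimately have "\<phi> (v S \<inter> \<psi> G) = {}" using G(2) by blast
    then show False using \<phi>_empty[OF face] ne by blast
  qed
  have sub: "v S \<subseteq> \<psi> G" if S: "card S = k" and G: "G face_of ?H" "indicator_vec S \<in> G" for S G
    unfolding v_def using \<psi>_mono[OF indicator_vec_face[OF S] G(1)] G(2) by simp
  define pre where "pre G = {x \<in> Q. L x + c \<in> \<psi> G}" for G
  have pre: "pre G face_of Q" if "G face_of ?H" for G
    unfolding pre_def
    by (rule face_of_affine_preimage[OF polytope_imp_convex[OF Q(1)] Q(2)])
       (use \<psi>(1)[OF that] Q(3) in simp)
  \<comment> \<open>A point \<open>q\<close> over the vertex of \<open>S\<close> lies outside
    \<open>pre G\<close>, so some facet \<open>R\<close> contains \<open>pre G\<close> and misses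
    \<open>q\<close>. Since \<open>q\<close> lies in \<open>pre G'\<close> for every face
    \<open>G'\<close> through that vertex, no such \<open>pre G'\<close> is inside \<open>R\<close>.
    The set \<open>T\<close> only ensures that \<open>pre G\<close> is nonempty.\<close>
  have separate: "\<exists>R\<in>facets Q. pre G \<subseteq> R \<and>
        (\<forall>G'. G' face_of ?H \<longrightarrow> pre G' \<subseteq> R \<longrightarrow> indicator_vec S \<notin> G')"
    if S: "card S = k" and G: "G face_of ?H" "indicator_vec S \<notin> G"
      and T: "card T = k" "indicator_vec T \<in> G" for S T G
  proof -
    obtain q where q: "q \<in> Q" "L q + c \<in> v S"
      using v[OF S] face_of_imp_subset Q(3) by blast
    obtain t where t: "t \<in> Q" "L t + c \<in> v T"
      using v[OF T(1)] face_of_imp_subset Q(3) by blast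
    have "t \<in> pre G"
      using t sub[OF T(1) G(1) T(2)] unfolding pre_def by blast
    moreover have "q \<in> Q - pre G"
      using q disj[OF S G] unfolding pre_def by blast
    ultimately obtain R where R: "R \<in> facets Q" "pre G \<subseteq> R" "q \<notin> R"
      using det pre[OF G(1)] unfolding facet_determined_def by blast
    have "indicator_vec S \<notin> G'" if "G' face_of ?H" "pre G' \<subseteq> R" for G'
    proof
      assume "indicator_vec S \<in> G'"
      then have "q \<in> pre G'"
        using q sub[OF S that(1)] unfolding pre_def by blast
      then show False using that(2) R(3) by blast
    qed
    then show ?thesis using R by blast
  qed
  define F where "F i = {x \<in> ?H. x $ i = 0}" for i
  define G where "G i = {x \<in> ?H. x $ i = 1}" for i
  have face: "F i face_of ?H" "G i face_of ?H" for i
    unfolding F_def G_def by (rule hypersimplex_faces)+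
  have in_FG: "indicator_vec S \<in> F i \<longleftrightarrow> i \<notin> S" "indicator_vec S \<in> G i \<longleftrightarrow> i \<in> S"
    if "card S = k" for S i
    using indicator_vec_in_hypersimplex[OF that] unfolding F_def G_def
    by (auto simp: indicator_vec_def)
  have "rect_cover UNIV k (facets Q) (\<lambda>R. {i. pre (F i) \<subseteq> R}) (\<lambda>R. {i. pre (G i) \<subseteq> R})"
  proof (rule rect_coverI)
    fix S :: "'n set" and i assume S: "card S = k"
    show "\<exists>R\<in>facets Q. i \<in> {i. pre (F i) \<subseteq> R} \<and> {i. pre (F i) \<subseteq> R} \<subseteq> S \<and> {i. pre (G i) \<subseteq> R} \<inter> S = {}"
      if i: "i \<in> S"
    proof -
      \<comment> \<open>Since \<open>k < n\<close>, the face \<open>x_i = 0\<close> has a vertex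
        \<open>T\<close>; for \<open>x_i = 1\<close> below, \<open>0 < k\<close> is what
        counts.\<close>
      have "k \<le> card (UNIV - {i})" using k by (simp add: card_Diff_singleton)
      then obtain T where T: "T \<subseteq> UNIV - {i}" "card T = k"
        by (meson obtain_subset_with_card_n)
      have "\<exists>R\<in>facets Q. pre (F i) \<subseteq> R \<and>
          (\<forall>G'. G' face_of ?H \<longrightarrow> pre G' \<subseteq> R \<longrightarrow> indicator_vec S \<notin> G')"
        by (rule separate[OF S face(1) _ T(2)]) (use T i in_FG(1)[OF S] in_FG(1)[OF T(2)] in auto)
      then obtain R where R: "R \<in> facets Q" "pre (F i) \<subseteq> R"
          "\<And>G'. G' face_of ?H \<Longrightarrow> pre G' \<subseteq> R \<Longrightarrow> indicator_vec S \<notin> G'"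
        by blast
      have "l \<in> S" if "pre (F l) \<subseteq> R" for l
        using R(3)[OF face(1) that] in_FG(1)[OF S] by simp
      moreover have "l \<notin> S" if "pre (G l) \<subseteq> R" for l
        using R(3)[OF face(2) that] in_FG(2)[OF S] by simp
      ultimately show ?thesis
        using R(1,2) by (intro bexI[of _ R]) auto
    qed
    show "\<exists>R\<in>facets Q. i \<in> {i. pre (G i) \<subseteq> R} \<and> {i. pre (F i) \<subseteq> R} \<subseteq> S \<and> {i. pre (G i) \<subseteq> R} \<inter> S = {}"
      if i: "i \<in> UNIV - S"
    proof -
      have "\<exists>T. {i} \<subseteq> T \<and> T \<subseteq> UNIV \<and> card T = k"
        by (rule exists_subset_between) (use k in auto)
      then obtain T where T: "i \<in> T" "card T = k" by blast
      have "\<exists>R\<in>facets Q. pre (G i) \<subseteq> R \<and>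
          (\<forall>G'. G' face_of ?H \<longrightarrow> pre G' \<subseteq> R \<longrightarrow> indicator_vec S \<notin> G')"
        by (rule separate[OF S face(2) _ T(2)]) (use T i in_FG(2)[OF S] in_FG(2)[OF T(2)] in auto)
      then obtain R where R: "R \<in> facets Q" "pre (G i) \<subseteq> R"
          "\<And>G'. G' face_of ?H \<Longrightarrow> pre G' \<subseteq> R \<Longrightarrow> indicator_vec S \<notin> G'"
        by blast
      have "l \<in> S" if "pre (F l) \<subseteq> R" for l
        using R(3)[OF face(1) that] in_FG(1)[OF S] by simp
      moreover have "l \<notin> S" if "pre (G l) \<subseteq> R" for l
        using R(3)[OF face(2) that] in_FG(2)[OF S] by simp
      ultimately show ?thesis
        using R(1,2) by (intro bexI[of _ R]) auto
    qed
  qed (use fin in auto)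
  then show "\<exists>A B. rect_cover (UNIV :: 'n set) k (facets Q) A B" by blast
qed

text \<open>A \<open>LEAST\<close> is informative only if some value qualifies: an embedded copy of
  \<open>P\<close> is an extension of \<open>P\<close>.\<close>

lemma extension_complexity_attained:
  fixes P :: "'a::euclidean_space set"
  assumes "polytope P"
  shows "\<exists>(Q :: (nat \<Rightarrow>\<^sub>0 real) set) L c. polytope Q \<and> linear L \<and> P = (\<lambda>x. L x + c) ` Q \<and>
    card (facets Q) = extension_complexity P"
  unfolding extension_complexity_def
proof (rule LeastI_ex)
  obtain e :: "'a \<Rightarrow> nat \<Rightarrow>\<^sub>0 real" where e: "linear e" "inj e"
    using linear_embedding_poly_mapping by blast
  obtain g where g: "linear g" "g \<circ> e = id"
    using linear_injective_left_inverse[OF e] by blast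
  have "polytope (e ` P)"
    by (rule polytope_linear_image[OF e(1) assms])
  moreover have "P = (\<lambda>x. g x + 0) ` e ` P"
    using g(2) by (simp add: image_comp[of g e P])
  ultimately show "\<exists>N (Q :: (nat \<Rightarrow>\<^sub>0 real) set) L c. polytope Q \<and> linear L \<and> P = (\<lambda>x. L x + c) ` Q \<and>
    card (facets Q) = N"
    using g(1) by blast
qed

text \<open>For \<open>k\<close> up to \<open>n / 2\<close> the covering bound applies directly,
  beyond that to the dual covering with parameter \<open>n - k\<close>.\<close>

theorem corollary1p3:
  fixes P :: "'a::euclidean_space set" and n k :: nat
  assumes "CARD('n::finite) = n"
    and "n \<ge> 6"
    and "0 < k" and "k < n"
    and "combinatorial_hypersimplex TYPE('n) k P"
  shows "(2 \<le> k \<and> int k < \<lfloor>real n / 2\<rfloor> \<longrightarrow>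
            extension_complexity P \<ge> n + 2 * k + 1) \<and>
         (\<lfloor>real n / 2\<rfloor> \<le> int k \<and> int k \<le> \<lceil>real n / 2\<rceil> \<longrightarrow>
            extension_complexity P \<ge> 2 * n) \<and>
         (\<lceil>real n / 2\<rceil> < int k \<and> k \<le> n - 2 \<longrightarrow>
            extension_complexity P \<ge> n + 2 * (n - k) + 1)"
proof -
  have "polytope P"
    using assms(5) unfolding combinatorial_hypersimplex_def by blast
  then obtain Q :: "(nat \<Rightarrow>\<^sub>0 real) set" and L c where Q: "polytope Q" "linear L"
      "P = (\<lambda>x. L x + c) ` Q" "card (facets Q) = extension_complexity P"
    using extension_complexity_attained by blast
  obtain A B where cov: "rect_cover (UNIV :: 'n set) k (facets Q) A B"
    using extension_rect_cover(2)[OF Q(1-3) assms(5,3)] assms(1,4) by blast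
  have dual: "rect_cover (UNIV :: 'n set) (n - k) (facets Q) B A"
    using rect_cover_dual[OF cov] assms(1,4) by simp
  have low: "(if 2 * k + 1 < n then n + 2 * k + 1 else 2 * n) \<le> extension_complexity P"
    if "2 \<le> k" "2 * k \<le> n"
    using rect_cover_lower_bound[OF cov assms(1,2) that] Q(4) by simp
  have high: "(if 2 * (n - k) + 1 < n then n + 2 * (n - k) + 1 else 2 * n) \<le> extension_complexity P"
    if "2 \<le> n - k" "2 * (n - k) \<le> n"
    using rect_cover_lower_bound[OF dual assms(1,2) that] Q(4) by simp
  have floor: "\<lfloor>real n / 2\<rfloor> = int (n div 2)"
    using floor_divide_of_nat_eq[of n 2] by simp
  have ceiling: "\<lceil>real n / 2\<rceil> = int ((n + 1) div 2)"
    by (rule ceiling_unique) (auto simp: field_simps real_of_nat_div split: if_splits)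
  show ?thesis
    unfolding floor ceiling
  proof (intro conjI impI)
    assume "2 \<le> k \<and> int k < int (n div 2)"
    then have "2 \<le> k" "2 * k + 1 < n" by linarith+
    then show "n + 2 * k + 1 \<le> extension_complexity P" using low by simp
  next
    assume k: "int (n div 2) \<le> int k \<and> int k \<le> int ((n + 1) div 2)"
    \<comment> \<open>In either case the strict inequality in the \<open>if\<close> fails, so
      \<open>low\<close> or \<open>high\<close> yields \<open>2 * n\<close>.\<close>
    then consider "2 * k \<le> n" "n \<le> 2 * k + 1" | "2 * (n - k) \<le> n" "n \<le> 2 * (n - k) + 1"
      using assms(2,4) by linarith
    then show "2 * n \<le> extension_complexity P"
    proof cases
      case 1
      then show ?thesis using low assms(2) by simp
    next
      case 2
      then show ?thesis using high assms(2) by simp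
    qed
  next
    assume "int ((n + 1) div 2) < int k \<and> k \<le> n - 2"
    then have "2 \<le> n - k" "2 * (n - k) + 1 < n" using assms(2,4) by linarith+
    then show "n + 2 * (n - k) + 1 \<le> extension_complexity P" using high by simp
  qed
qed

end
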